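(* Let $L\ge1$ be an integer and let $v,a,b\in\{0,1\}^L$ with $b\notin\{a,a^R,\bar a,\bar a^R\}$. Then, as $n\to\infty$, \[\mathrm{P}\{C_n(a)=C_n(b)\mid (X)^L_L=v\}=\sqrt{\frac{2^{L-2}\,q}{p\,\pi n}}+o(1/\sqrt n).\]
   Context: $(X_i,i\ge1)$ is a symmetric Bernoulli process: i.i.d. random variables with $\mathrm{P}\{X_i=0\}=\mathrm{P}\{X_i=1\}=1/2$. For a word $x=(x_1,\dots,x_L)\in\{0,1\}^L$, $x^R=(x_L,\dots,x_1)$ is its reversal, $\bar x=(1-x_1,\dots,1-x_L)$ its conjugate, and $\bar x^R$ the reversal of $\bar x$. For a word $y$ of length $m\ge 1$, $C_n(y)=\sum_{k=m}^n \mathbf 1\{(X_{k-m+1},\dots,X_k)=y\}$ is the number of (possibly overlapping) occurrences of $y$ in $X_1,\dots,X_n$ (equal to $0$ if $n<m$). For $t\ge L$ let $(X)^L_t=(X_{t-L+1},\dots,X_t)$ (so $(X)^L_L=(X_1,\dots,X_L)$); for $t<L$ let $(X)^L_t$ be the empty word. Let $T_0=0$ and $T_k=\min\{t>T_{k-1}:(X)^L_t\in\{a,b\}\}$ for $k\ge1$ (almost surely finite). Let $Y_k=1$ if $(X)^L_{T_k}=a$ and $Y_k=-1$ if $(X)^L_{T_k}=b$. The sequence $(Y_k)_{k\ge1}$ is a time-homogeneous Markov chain on $\{\pm1\}$ and $\mathrm{P}\{Y_2=1\mid Y_1=1\}=\mathrm{P}\{Y_2=-1\mid Y_1=-1\}$;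 this common value is denoted $p$, and $q=1-p$. *)

theory Defs
  imports "HOL-Probability.Probability" "HOL-Library.Landau_Symbols"
begin

text \<open>Letters are booleans, \<open>True\<close> standing for 1 and \<open>False\<close> for 0; words are lists of letters,
  so the reversal of a word \<open>x\<close> is \<open>rev x\<close> and its conjugate is \<open>map Not x\<close>.
  The process is indexed from 1; \<open>X 0\<close> is irrelevant.\<close>

locale symmetric_bernoulli_process = prob_space M
  for M :: "'a measure" +
  fixes X :: "nat \<Rightarrow> 'a \<Rightarrow> bool"
  assumes indep: "indep_vars (\<lambda>_. count_space UNIV) X {1..}"
    and prob_one: "\<And>i. i \<ge> 1 \<Longrightarrow> \<P>(\<omega> in M. X i \<omega> = True) = 1 / 2"
    and prob_zero: "\<And>i. i \<ge> 1 \<Longrightarrow> \<P>(\<omega> in M. X i \<omega> = False) = 1 / 2"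

definition window :: "(nat \<Rightarrow> 'a \<Rightarrow> bool) \<Rightarrow> nat \<Rightarrow> nat \<Rightarrow> 'a \<Rightarrow> bool list" where
  "window X L t \<omega> = (if t < L then [] else map (\<lambda>i. X i \<omega>) [t + 1 - L..<t + 1])"

definition occurrences :: "(nat \<Rightarrow> 'a \<Rightarrow> bool) \<Rightarrow> nat \<Rightarrow> bool list \<Rightarrow> 'a \<Rightarrow> nat" where
  "occurrences X n y \<omega> = (\<Sum>k = length y..n. of_bool (window X (length y) k \<omega> = y))"

text \<open>The minimum exists almost surely; on the exceptional null set \<open>LEAST\<close> yields some
  unspecified number, which does not affect any probability.\<close>

primrec hit_time ::
  "(nat \<Rightarrow> 'a \<Rightarrow> bool) \<Rightarrow> nat \<Rightarrow> bool list \<Rightarrow> bool list \<Rightarrow> nat \<Rightarrow> 'a \<Rightarrow> nat" where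
  "hit_time X L a b 0 \<omega> = 0"
| "hit_time X L a b (Suc k) \<omega> =
     (LEAST t. t > hit_time X L a b k \<omega> \<and> window X L t \<omega> \<in> {a, b})"

definition hit_sign ::
  "(nat \<Rightarrow> 'a \<Rightarrow> bool) \<Rightarrow> nat \<Rightarrow> bool list \<Rightarrow> bool list \<Rightarrow> nat \<Rightarrow> 'a \<Rightarrow> int" where
  "hit_sign X L a b k \<omega> =
     (if window X L (hit_time X L a b k \<omega>) \<omega> = a then 1
      else if window X L (hit_time X L a b k \<omega>) \<omega> = b then - 1
      else 0)"

text \<open>For \<open>a \<noteq> b\<close> of length \<open>L \<ge> 1\<close> this is also the conditional probability of
  \<open>Y\<^sub>2 = -1\<close> given \<open>Y\<^sub>1 = -1\<close>, where \<open>Y\<^sub>k\<close> is \<open>hit_sign X L a b k\<close>.\<close>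

definition stay_prob ::
  "'a measure \<Rightarrow> (nat \<Rightarrow> 'a \<Rightarrow> bool) \<Rightarrow> nat \<Rightarrow> bool list \<Rightarrow> bool list \<Rightarrow> real" where
  "stay_prob M X L a b =
     \<P>(\<omega> in M. hit_sign X L a b 2 \<omega> = 1 \<bar> hit_sign X L a b 1 \<omega> = 1)"

end

theory Submission imports Defs begin

text \<open>Reading an occurrence of \<open>a\<close> as \<open>+1\<close> and one of \<open>b\<close> as \<open>-1\<close>, a word gets a score, and the event
is that \<open>X\<^sub>1 \<dots> X\<^sub>n\<close> has score zero. All words of length \<open>n\<close> are equally likely, so probabilities
and expectations are averages over finite words. The claim is a local limit theorem for the score,
whose steps depend on each other only over a range of \<open>L\<close> letters and have mean zero. By Fourier
inversion the probability of score zero is the mean over \<open>[-pi, pi]\<close> of the characteristic function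
\<open>score_char\<close>, and after the substitution \<open>t / sqrt n\<close> dominated convergence gives the limit
\<open>1 / sqrt (2 * pi * svar)\<close> of \<open>sqrt n\<close> times this probability (\<open>local_limit\<close>). Three things are needed.

Domination. If two words of the same length can replace each other inside every word at the cost of
exactly one point (\<open>swap_pair\<close>), then each block of the random word contains, with fixed probability,
a fair coin deciding about one point, and the characteristic function decays like
\<open>exp (- c * t\<^sup>2 * n)\<close> uniformly for \<open>\<bar>t\<bar> \<le> pi\<close> (\<open>score_char_bound\<close>). The assumption on \<open>b\<close> provides such a pair
(\<open>swap_pair_exists\<close>). It cannot be dropped: for \<open>b = rev a\<close> with \<open>a = 01\<dots>1\<close>, say, the occurrences of
\<open>a\<close> and \<open>b\<close> alternate, and for \<open>a = 00\<close>, \<open>b = 11\<close> the score is tied to a parity.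

Gaussian limit. Cut the word into blocks of a fixed length \<open>K\<close>. The scores of the blocks are
independent; the windows across the cuts contribute uncorrelated terms of bounded variance, hence
together only a fraction of order \<open>1 / sqrt K\<close> of the standard deviation (\<open>score_char_approx_power\<close>).
Letting first \<open>n\<close> and then \<open>K\<close> tend to infinity gives the central limit theorem, \<open>score_char_limit\<close>,
with the variance per letter \<open>svar\<close>.

Identification of the variance. Let \<open>drift u\<close> be the expected score still to come from windows that
begin inside the past \<open>u\<close>. Comparing words of length \<open>n\<close> and \<open>n + 1\<close> gives
\<open>svar = (2 + 2 * (drift a - drift b)) / 2 ^ L\<close> (\<open>second_moment_step\<close>). On the other hand
score plus drift is a martingale, and stopping it at the first occurrence of \<open>a\<close> or \<open>b\<close> after an
initial \<open>a\<close> gives \<open>(1 - p) * (drift a - drift b + 1) = p\<close> (\<open>drift_equation\<close>), where \<open>p\<close> is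
the probability that this occurrence is again \<open>a\<close>. So \<open>svar = 2 * p / (q * 2 ^ L)\<close>, and the
strong Markov property identifies \<open>p\<close> with the conditional probability in the statement
(\<open>stay_prob_eq\<close>).\<close>

section \<open>Averages over words\<close>

definition words :: "nat \<Rightarrow> bool list set" where
  "words n = {xs. length xs = n}"

definition avg :: "nat \<Rightarrow> (bool list \<Rightarrow> 'c::real_normed_field) \<Rightarrow> 'c" where
  "avg n F = (\<Sum>xs\<in>words n. F xs) / 2 ^ n"

lemma words_0: "words 0 = {[]}"
  by (auto simp: words_def)

lemma words_add: "bij_betw (\<lambda>(x, y). x @ y) (words m \<times> words n) (words (m + n))"
proof (rule bij_betwI[where g = "\<lambda>xs. (take m xs, drop m xs)"])
qed (auto simp: words_def)

lemma words_1: "words (Suc 0) = {[True], [False]}"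
  by (auto simp: words_def length_Suc_conv)

lemma finite_words [simp]: "finite (words n)"
  unfolding words_def using finite_lists_length_eq[of "UNIV :: bool set" n] by simp

lemma card_words [simp]: "card (words n) = 2 ^ n"
  unfolding words_def using card_lists_length_eq[of "UNIV :: bool set" n] by simp

lemma length_words: "xs \<in> words n \<Longrightarrow> length xs = n"
  by (simp add: words_def)

lemma avg_append: "avg (m + n) F = avg m (\<lambda>x. avg n (\<lambda>y. F (x @ y)))"
proof -
  have "(\<Sum>xs\<in>words (m + n). F xs) = (\<Sum>(x, y)\<in>words m \<times> words n. F (x @ y))"
    using sum.reindex_bij_betw[OF words_add, of F m n] by (simp add: case_prod_unfold)
  also have "\<dots> = (\<Sum>x\<in>words m. \<Sum>y\<in>words n. F (x @ y))"
    by (simp add: sum.cartesian_product)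
  finally show ?thesis
    by (simp add: avg_def power_add sum_divide_distrib field_simps)
qed

lemma avg_const [simp]: "avg n (\<lambda>_. c) = c"
  by (simp add: avg_def)

lemma avg_0 [simp]: "avg 0 F = F []"
  by (simp add: avg_def words_0)

lemma avg_1: "avg (Suc 0) F = (F [True] + F [False]) / 2"
  by (simp add: avg_def words_1)

lemma avg_cong: "(\<And>xs. length xs = n \<Longrightarrow> F xs = G xs) \<Longrightarrow> avg n F = avg n G"
  unfolding avg_def by (metis (no_types, lifting) length_words sum.cong)

lemma avg_add: "avg n (\<lambda>x. F x + G x) = avg n F + avg n G"
  by (simp add: avg_def sum.distrib add_divide_distrib)

lemma avg_diff: "avg n (\<lambda>x. F x - G x) = avg n F - avg n G"
  by (simp add: avg_def sum_subtractf diff_divide_distrib)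

lemma avg_cmult: "avg n (\<lambda>x. c * F x) = c * avg n F"
  by (simp add: avg_def sum_distrib_left)

lemma avg_cmult_right: "avg n (\<lambda>x. F x * c) = avg n F * c"
  by (simp add: avg_def sum_distrib_right)

lemma avg_point:
  assumes "length w = n"
  shows "avg n (\<lambda>y. of_bool (y = w) * F y) = F w / 2 ^ n"
proof -
  have "(\<Sum>y\<in>words n. of_bool (y = w) * F y) = (\<Sum>y\<in>{w}. of_bool (y = w) * F y)"
    using assms by (intro sum.mono_neutral_right) (auto simp: words_def[symmetric], auto simp: words_def)
  then show ?thesis by (simp add: avg_def)
qed

lemma avg_of_real: "avg n (\<lambda>x. of_real (F x)) = of_real (avg n F)"
  by (simp add: avg_def)

lemma avg_mono:
  fixes F G :: "bool list \<Rightarrow> real"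
  shows "(\<And>xs. length xs = n \<Longrightarrow> F xs \<le> G xs) \<Longrightarrow> avg n F \<le> avg n G"
  unfolding avg_def by (intro divide_right_mono sum_mono) (auto simp: words_def)

lemma norm_avg_le: "norm (avg n F) \<le> avg n (\<lambda>x. norm (F x))"
  unfolding avg_def by (simp add: norm_divide norm_power divide_right_mono norm_sum)

lemma norm_avg_le_const:
  assumes "\<And>xs. length xs = n \<Longrightarrow> norm (F xs) \<le> c"
  shows "norm (avg n F) \<le> c"
proof -
  have "norm (avg n F) \<le> avg n (\<lambda>x. norm (F x))" by (rule norm_avg_le)
  also have "\<dots> \<le> avg n (\<lambda>_. c)" by (rule avg_mono) (use assms in auto)
  finally show ?thesis by simp
qed

lemma avg_tl: "avg (Suc n) (\<lambda>xs. F (tl xs)) = avg n F"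
  using avg_append[of "Suc 0" n "\<lambda>xs. F (tl xs)"] by (simp add: avg_1)

lemma avg_abs_le_sqrt:
  fixes F :: "bool list \<Rightarrow> real"
  assumes "avg n (\<lambda>x. (F x)\<^sup>2) \<le> c\<^sup>2" "c \<ge> 0"
  shows "avg n (\<lambda>x. \<bar>F x\<bar>) \<le> c"
proof (cases "c = 0")
  case False
  with assms(2) have "c > 0" by simp
  have "\<bar>F x\<bar> \<le> (F x)\<^sup>2 * (1 / (2 * c)) + c / 2" for x
  proof -
    have "0 \<le> (\<bar>F x\<bar> - c)\<^sup>2" by simp
    then show ?thesis using \<open>c > 0\<close> by (simp add: power2_diff field_simps power2_eq_square)
  qed
  then have "avg n (\<lambda>x. \<bar>F x\<bar>) \<le> avg n (\<lambda>x. (F x)\<^sup>2 * (1 / (2 * c)) + c / 2)"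
    by (intro avg_mono)
  also have "\<dots> = avg n (\<lambda>x. (F x)\<^sup>2) * (1 / (2 * c)) + c / 2"
    by (simp only: avg_add avg_cmult_right avg_const)
  also have "\<dots> \<le> c\<^sup>2 * (1 / (2 * c)) + c / 2"
    using assms \<open>c > 0\<close> by (intro add_right_mono mult_right_mono) auto
  also have "\<dots> = c" using \<open>c > 0\<close> by (simp add: field_simps power2_eq_square)
  finally show ?thesis .
next
  case True
  then have "(\<Sum>x\<in>words n. (F x)\<^sup>2) \<le> 0"
    using assms(1) by (simp add: avg_def field_simps)
  then have "(\<Sum>x\<in>words n. (F x)\<^sup>2) = 0" by (intro antisym sum_nonneg) auto
  then have "\<forall>x\<in>words n. F x = 0" by (simp add: sum_nonneg_eq_0_iff)
  then show ?thesis using True by (simp add: avg_def)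
qed

section \<open>The score of a word\<close>

locale word_pair =
  fixes L :: nat and a b :: "bool list"
  assumes L_pos: "L \<ge> 1" and len_a: "length a = L" and len_b: "length b = L" and a_ne_b: "a \<noteq> b"
begin

definition sgn_word :: "bool list \<Rightarrow> int" where
  "sgn_word y = of_bool (y = a) - of_bool (y = b)"

primrec score :: "bool list \<Rightarrow> int" where
  "score [] = 0"
| "score (x # w) = sgn_word (take L (x # w)) + score w"

lemma sgn_word_simps [simp]: "sgn_word a = 1" "sgn_word b = - 1"
  using a_ne_b by (auto simp: sgn_word_def)

lemma sgn_word_other: "y \<noteq> a \<Longrightarrow> y \<noteq> b \<Longrightarrow> sgn_word y = 0"
  by (auto simp: sgn_word_def)

lemma sgn_word_length: "length y \<noteq> L \<Longrightarrow> sgn_word y = 0"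
  using len_a len_b by (intro sgn_word_other) auto

lemma sgn_word_abs: "\<bar>sgn_word y\<bar> \<le> 1"
  by (auto simp: sgn_word_def)

lemma sgn_word_eq_iff:
  "sgn_word y = 1 \<longleftrightarrow> y = a" "sgn_word y = - 1 \<longleftrightarrow> y = b" "sgn_word y = 0 \<longleftrightarrow> y \<notin> {a, b}"
  using a_ne_b by (auto simp: sgn_word_def)

lemma score_short: "length w < L \<Longrightarrow> score w = 0"
  by (induction w) (auto intro: sgn_word_length)

lemma score_full: "length w = L \<Longrightarrow> score w = sgn_word w"
  using L_pos by (cases w) (auto simp: score_short)

text \<open>A window that begins in \<open>x\<close> reaches at most \<open>L - 1\<close> letters beyond it. This lemma and its mirror
image \<open>score_append_drop\<close> express that the score has range \<open>L\<close>; all independence and all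
replacement arguments below rest on them.\<close>
lemma score_append_take: "score (x @ y) = score (x @ take (L - 1) y) + score y"
proof (induction x)
  case Nil
  show ?case using L_pos by (simp add: score_short)
next
  case (Cons z x)
  have "take L (z # x @ y) = take L (z # x @ take (L - 1) y)"
    using L_pos by (cases L) (auto simp: min_def)
  then show ?case using Cons by simp
qed

lemma score_append_drop:
  "score (x @ y) = score x + score (drop (length x - (L - 1)) x @ y)"
proof (induction x)
  case (Cons z x)
  show ?case
  proof (cases "length (z # x) \<le> L - 1")
    case True
    then have "score (z # x) = 0" using L_pos by (intro score_short) auto
    then show ?thesis using True by simp
  next
    case False
    then have "take L (z # x @ y) = take L (z # x)"
      by (cases L) auto
    moreover have "drop (length (z # x) - (L - 1)) (z # x) = drop (length x - (L - 1)) x"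
      using False by (simp add: Suc_diff_le)
    ultimately show ?thesis using Cons by simp
  qed
qed simp

lemma score_snoc: "score (u @ [x]) = score u + sgn_word (drop (length u + 1 - L) (u @ [x]))"
proof -
  have eq: "drop (length u - (L - 1)) u @ [x] = drop (length u + 1 - L) (u @ [x])"
    using L_pos by (cases L) auto
  have "score (u @ [x]) = score u + score (drop (length u - (L - 1)) u @ [x])"
    by (rule score_append_drop)
  also have "score (drop (length u - (L - 1)) u @ [x]) = sgn_word (drop (length u + 1 - L) (u @ [x]))"
  proof (cases "length u + 1 < L")
    case True
    then show ?thesis by (simp add: eq score_short sgn_word_length)
  next
    case False
    then show ?thesis by (subst eq, intro score_full) auto
  qed
  finally show ?thesis .
qed

lemma score_append_abs_left: "\<bar>score (x @ y) - score y\<bar> \<le> int (length x)"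
proof (induction x)
  case (Cons z x)
  have "\<bar>sgn_word (take L (z # x @ y))\<bar> \<le> 1" by (rule sgn_word_abs)
  then show ?case using Cons by simp
qed simp

lemma score_append_abs_right: "\<bar>score (x @ y) - score x\<bar> \<le> int (length y)"
proof (induction y rule: rev_induct)
  case (snoc z y)
  show ?case
    using snoc score_snoc[of "x @ y" z] sgn_word_abs[of "drop (length (x @ y) + 1 - L) ((x @ y) @ [z])"]
    unfolding append_assoc by (simp only: length_append_singleton)
qed simp

lemma score_abs: "\<bar>score x\<bar> \<le> int (length x)"
  using score_append_abs_left[of x "[]"] by simp

lemma avg_sgn_word: "avg L (\<lambda>y. of_int (sgn_word y) * F y) = (F a - F b) / 2 ^ L"
proof -
  have "(\<Sum>y\<in>words L. of_int (sgn_word y) * F y) = (\<Sum>y\<in>{a, b}. of_int (sgn_word y) * F y)"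
    by (rule sum.mono_neutral_right) (use len_a len_b in \<open>auto simp: sgn_word_def words_def[symmetric]\<close>, auto simp: words_def)
  then show ?thesis using a_ne_b by (simp add: avg_def)
qed

lemma avg_sgn_word_0: "avg L (\<lambda>y. of_int (sgn_word y)) = (0::'c::real_normed_field)"
  using avg_sgn_word[of "\<lambda>_. 1 :: 'c"] by simp

text \<open>A window that consists of fresh letters has mean score zero, because \<open>a\<close> and \<open>b\<close> are equally
  likely.\<close>
lemma avg_score_snoc:
  assumes "n + 1 \<ge> L"
  shows "avg (Suc n) (\<lambda>xs. of_int (score (u @ xs))) = avg n (\<lambda>xs. of_int (score (u @ xs)) :: real)"
proof -
  have "n + 1 - L + L = Suc n" using assms by simp
  have "avg (Suc n) (\<lambda>xs. of_int (score (u @ xs)) :: real)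
      = avg (n + Suc 0) (\<lambda>xs. of_int (score (u @ butlast xs)) + of_int (sgn_word (drop (n + 1 - L) xs)))"
    unfolding add_Suc_right add_0_right
  proof (rule avg_cong)
    fix xs :: "bool list" assume xs: "length xs = Suc n"
    then obtain ys y where [simp]: "xs = ys @ [y]" by (metis append_butlast_last_id list.size(3) nat.distinct(1))
    have "drop (length (u @ ys) + 1 - L) ((u @ ys) @ [y]) = drop (n + 1 - L) (ys @ [y])"
      using xs assms by simp
    then show "of_int (score (u @ xs)) = of_int (score (u @ butlast xs)) + (of_int (sgn_word (drop (n + 1 - L) xs)) :: real)"
      using score_snoc[of "u @ ys" y] by simp
  qed
  also have "\<dots> = avg (n + Suc 0) (\<lambda>xs. of_int (score (u @ butlast xs)))
     + avg (n + 1 - L + L) (\<lambda>xs. of_int (sgn_word (drop (n + 1 - L) xs)))"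
    by (simp only: avg_add \<open>n + 1 - L + L = Suc n\<close> add_Suc_right add_0_right)
  also have "avg (n + 1 - L + L) (\<lambda>xs. of_int (sgn_word (drop (n + 1 - L) xs)) :: real)
      = avg (n + 1 - L) (\<lambda>x. avg L (\<lambda>y. of_int (sgn_word y)))"
    unfolding avg_append by (rule avg_cong) simp
  also have "\<dots> = 0" by (simp only: avg_sgn_word_0 avg_const)
  also have "avg (n + Suc 0) (\<lambda>xs. of_int (score (u @ butlast xs))) = avg n (\<lambda>xs. of_int (score (u @ xs)) :: real)"
    unfolding avg_append by (simp add: avg_1 butlast_append)
  finally show ?thesis by simp
qed

lemma avg_score_stable:
  assumes "m \<ge> L - 1" "n \<ge> m"
  shows "avg n (\<lambda>xs. of_int (score (u @ xs))) = avg m (\<lambda>xs. of_int (score (u @ xs)) :: real)"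
  using assms(2)
proof (induction rule: dec_induct)
  case (step n)
  then show ?case using assms(1) by (subst avg_score_snoc) auto
qed simp

lemma avg_score_0: "avg n (\<lambda>xs. of_int (score xs)) = (0::real)"
proof (cases "n \<ge> L - 1")
  case True
  have "avg n (\<lambda>xs. of_int (score ([] @ xs)) :: real) = avg (L - 1) (\<lambda>xs. of_int (score ([] @ xs)))"
    using True by (intro avg_score_stable) auto
  also have "\<dots> = avg (L - 1) (\<lambda>_. 0)" 
    using L_pos by (intro avg_cong) (simp add: score_short)
  finally show ?thesis by simp
next
  case False
  then have "avg n (\<lambda>xs. of_int (score xs) :: real) = avg n (\<lambda>_. 0)"
    by (intro avg_cong) (simp add: score_short)
  then show ?thesis by simp
qed

section \<open>Exchangeable words\<close>


text \<open>Windows that straddle an end of a factor see at most \<open>L - 1\<close> letters of it. Two words of the same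
length that agree in their first and last \<open>L - 1\<close> letters can therefore replace each other inside
any word, and the score changes by the same amount everywhere.\<close>
definition swap_pair :: "bool list \<Rightarrow> bool list \<Rightarrow> bool" where
  "swap_pair x y \<longleftrightarrow> length x = length y \<and> length x \<ge> L \<and> take (L - 1) x = take (L - 1) y \<and>
     drop (length x - (L - 1)) x = drop (length y - (L - 1)) y \<and> \<bar>score x - score y\<bar> = 1"

lemma swap_pair_score:
  assumes "swap_pair x y"
  shows "score (r @ x @ s) = score (r @ y @ s) + (score x - score y)"
proof -
  have *: "score (r @ z @ s) = score (r @ take (L - 1) z) + score z + score (drop (length z - (L - 1)) z @ s)"
    if "length z \<ge> L" for z
    using that score_append_take[of r "z @ s"] score_append_drop[of z s] by simp
  show ?thesis
    using assms unfolding swap_pair_def by (subst (1 2) *) auto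
qed

text \<open>Writing \<open>L = length x + 2\<close>, the only window that sees letters on both sides of an occurrence of \<open>x\<close>
is \<open>x\<close> with its two neighbours. The score of a word that passes through \<open>x\<close> splits there.\<close>
lemma score_split_middle:
  assumes "length x + 2 = L"
  shows "score (p @ [s] @ x @ [t] @ q) = score (p @ [s] @ x) + sgn_word ([s] @ x @ [t]) + score (x @ [t] @ q)"
proof -
  have "drop (length (p @ [s] @ x) - (L - 1)) (p @ [s] @ x) = [s] @ x"
    using assms by auto
  then have "score ((p @ [s] @ x) @ [t] @ q) = score (p @ [s] @ x) + score (([s] @ x) @ [t] @ q)"
    using score_append_drop[of "p @ [s] @ x" "[t] @ q"] by simp
  moreover have "take L (s # x @ t # q) = s # x @ [t]"
    using assms by auto
  ultimately show ?thesis by simp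
qed

lemma score_eq_0:
  "(\<And>i. i + L \<le> length w \<Longrightarrow> take L (drop i w) \<notin> {a, b}) \<Longrightarrow> score w = 0"
proof (induction w)
  case (Cons z w)
  have "sgn_word (take L (z # w)) = 0"
  proof (cases "L \<le> length (z # w)")
    case True
    then show ?thesis using Cons.prems[of 0] by (simp add: sgn_word_eq_iff)
  next
    case False
    then show ?thesis by (intro sgn_word_length) auto
  qed
  moreover have "score w = 0"
    using Cons.prems[of "Suc i" for i] by (intro Cons.IH) auto
  ultimately show ?case by simp
qed simp

lemma score_eq_0_middle:
  assumes "length x + 2 = L" "a = [c] @ x @ [d]" "b = [c'] @ x @ [d']"
    and "\<And>i. i + L \<le> length w \<Longrightarrow> take (length x) (drop (Suc i) w) \<noteq> x"
  shows "score w = 0"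
proof (rule score_eq_0)
  fix i assume i: "i + L \<le> length w"
  have "take (length x) (drop 1 (take L (drop i w))) = take (length x) (drop (Suc i) w)"
    using assms(1) by (simp add: drop_take)
  then have "take (length x) (drop 1 (take L (drop i w))) \<noteq> x"
    using assms(4)[OF i] by simp
  then show "take L (drop i w) \<notin> {a, b}"
    using assms(2,3) by auto
qed

text \<open>For \<open>a = e\<dots>e\<close>, moving the border between a run of \<open>e\<close> and a run of the other letter by one place
removes one window \<open>a\<close>, and adds a constant window different from \<open>b\<close>.\<close>
lemma swap_pair_const:
  assumes "a = replicate L e" "b \<noteq> replicate L (\<not> e)"
  shows "\<exists>x y. swap_pair x y"
proof -
  let ?X = "replicate L e @ replicate (L - 1) (\<not> e)"
  let ?Y = "replicate (L - 1) e @ replicate L (\<not> e)"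
  let ?Z = "replicate (L - 1) e @ replicate (L - 1) (\<not> e)"
  have X: "?X = e # ?Z" and Y: "?Y = ?Z @ [\<not> e]"
    using L_pos by (cases L; simp add: replicate_append_same)+
  have "take L ?X = a" using assms by simp
  then have "score ?X = 1 + score ?Z" unfolding X by simp
  moreover have "score ?Y = score ?Z"
  proof -
    have "drop (length ?Z + 1 - L) (?Z @ [\<not> e]) = replicate L (\<not> e)"
      unfolding Y[symmetric] using L_pos by simp
    moreover have "replicate L (\<not> e) \<noteq> a"
      using assms(1) L_pos by simp
    ultimately show ?thesis
      unfolding Y score_snoc using assms(2) by (simp add: sgn_word_other)
  qed
  ultimately have "\<bar>score ?X - score ?Y\<bar> = 1" by simp
  moreover have "take (L - 1) ?X = take (L - 1) ?Y" by simp
  moreover have "drop (length ?X - (L - 1)) ?X = drop (length ?Y - (L - 1)) ?Y"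
    using L_pos by simp
  ultimately have "swap_pair ?X ?Y"
    unfolding swap_pair_def using L_pos by simp
  then show ?thesis by blast
qed

text \<open>Two factors between occurrences of \<open>x\<close> are exchanged. By \<open>score_split_middle\<close> only the windows
with middle part \<open>x\<close> are affected, and with the letters chosen here the change is that
\<open>[c] @ x @ [d]\<close> and its opposite \<open>[\<not> c] @ x @ [\<not> d]\<close> are traded for
\<open>[c] @ x @ [\<not> d]\<close> and \<open>[\<not> c] @ x @ [d]\<close>. If \<open>b\<close> has another middle part,
the only relevant word among these four is \<open>a\<close>.\<close>
lemma swap_pair_exchange:
  assumes k: "length x + 2 = L" and a: "a = [c] @ x @ [d]" and b: "b = [c'] @ x' @ [d']" and "x \<noteq> x'" "length x' = length x"
  shows "\<exists>x y. swap_pair x y"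
proof -
  let ?X = "[] @ [c] @ x @ [d] @ [\<not> c] @ x @ [\<not> d] @ x @ [d]"
  let ?Y = "[] @ [c] @ x @ [\<not> d] @ x @ [d] @ [\<not> c] @ x @ [d]"
  have sgn: "sgn_word ([s] @ x @ [t]) = of_bool (s = c \<and> t = d)" for s t
  proof -
    have "[s] @ x @ [t] \<noteq> b" "[s] @ x @ [t] = a \<longleftrightarrow> s = c \<and> t = d" using a b assms(4,5) by auto
    then show ?thesis by (simp only: sgn_word_def) simp
  qed
  have "score ?X = score ([c] @ x) + sgn_word ([c] @ x @ [d]) + score (x @ [d] @ [\<not> c] @ x @ [\<not> d] @ x @ [d])"
    by (subst score_split_middle[OF k]) simp
  also have "score (x @ [d] @ [\<not> c] @ x @ [\<not> d] @ x @ [d]) = score (x @ [d] @ [\<not> c] @ x)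
      + sgn_word ([\<not> c] @ x @ [\<not> d]) + score (x @ [\<not> d] @ x @ [d])"
    using score_split_middle[OF k, of "x @ [d]" "\<not> c" "\<not> d" "x @ [d]"] by simp
  also have "score (x @ [\<not> d] @ x @ [d]) = score (x @ [\<not> d] @ x) + sgn_word ([\<not> d] @ x @ [d]) + score (x @ [d])"
    using score_split_middle[OF k, of "x" "\<not> d" "d" "[]"] by simp
  finally have X: "score ?X = score ([c] @ x) + 1 + score (x @ [d] @ [\<not> c] @ x) + score (x @ [\<not> d] @ x)
      + of_bool (\<not> d \<longleftrightarrow> c) + score (x @ [d])"
    by (simp only: sgn) auto
  have "score ?Y = score ([c] @ x) + sgn_word ([c] @ x @ [\<not> d]) + score (x @ [\<not> d] @ x @ [d] @ [\<not> c] @ x @ [d])"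
    by (subst score_split_middle[OF k]) simp
  also have "score (x @ [\<not> d] @ x @ [d] @ [\<not> c] @ x @ [d]) = score (x @ [\<not> d] @ x)
      + sgn_word ([\<not> d] @ x @ [d]) + score (x @ [d] @ [\<not> c] @ x @ [d])"
    using score_split_middle[OF k, of "x" "\<not> d" "d" "[\<not> c] @ x @ [d]"] by simp
  also have "score (x @ [d] @ [\<not> c] @ x @ [d]) = score (x @ [d] @ [\<not> c] @ x) + sgn_word ([\<not> c] @ x @ [d]) + score (x @ [d])"
    using score_split_middle[OF k, of "x @ [d]" "\<not> c" "d" "[]"] by simp
  finally have Y: "score ?Y = score ([c] @ x) + score (x @ [d] @ [\<not> c] @ x) + score (x @ [\<not> d] @ x)
      + of_bool (\<not> d \<longleftrightarrow> c) + score (x @ [d])"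
    by (simp only: sgn) auto
  have "\<bar>score ?X - score ?Y\<bar> = 1"
    unfolding X Y by simp
  moreover have "take (L - 1) ?X = take (L - 1) ?Y" using k by auto
  moreover have "drop (length ?X - (L - 1)) ?X = drop (length ?Y - (L - 1)) ?Y"
  proof -
    have "drop (length (p @ x @ [d]) - (L - 1)) (p @ x @ [d]) = x @ [d]" for p
      using k by auto
    from this[of "[c] @ x @ [d] @ [\<not> c] @ x @ [\<not> d]"] this[of "[c] @ x @ [\<not> d] @ x @ [d] @ [\<not> c]"]
    show ?thesis by (simp only: append.assoc append_Nil)
  qed
  ultimately have "swap_pair ?X ?Y"
    unfolding swap_pair_def using k by (intro conjI) auto
  then show ?thesis by blast
qed

lemma Cons_butlast_eq_imp_replicate: "x \<noteq> [] \<Longrightarrow> s # butlast x = x \<Longrightarrow> x = replicate (length x) s"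
proof (induction x arbitrary: s)
  case (Cons y x)
  show ?case
  proof (cases "x = []")
    case False
    with Cons.prems have "s = y" "y # butlast x = x" by auto
    with Cons.IH[of y] False show ?thesis by simp
  qed (use Cons.prems in auto)
qed simp

lemma tl_snoc_eq_imp_replicate: 
  assumes "x \<noteq> []" "tl x @ [s] = x" shows "x = replicate (length x) s"
proof -
  have "s # butlast (rev x) = rev x"
    using arg_cong[OF assms(2), of rev] by (simp add: butlast_rev)
  then have "rev x = replicate (length x) s"
    using Cons_butlast_eq_imp_replicate[of "rev x" s] assms(1) by simp
  then show ?thesis
    by (metis rev_replicate rev_rev_ident)
qed

text \<open>If \<open>a\<close> and \<open>b\<close> have the same middle part \<open>x\<close>, only windows with middle part \<open>x\<close> count. After a run
of the letter that is not the first one of \<open>x\<close>, the word \<open>x\<close> cannot begin inside the run, and it cannot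
begin at the last letter before \<open>x\<close> either unless it is constant. So the word below
has its only relevant window at the end, and it ceases to be \<open>a\<close> when its first letter is negated.\<close>
lemma swap_pair_prefix:
  assumes k: "length x + 2 = L" and a: "a = [c] @ x @ [d]" and b: "b = [c'] @ x @ [d']"
    and x: "\<And>e. x \<noteq> replicate (length x) e" and ne: "b \<noteq> [\<not> c] @ x @ [d]"
  shows "\<exists>x y. swap_pair x y"
proof -
  define g where "g = (\<not> hd x)"
  let ?k = "length x"
  have x0: "x \<noteq> []" using x[of True] by auto
  let ?P = "replicate (Suc ?k) g"
  have *: "score (?P @ [s] @ x) = 0" for s
  proof (rule score_eq_0_middle[OF k a b])
    fix i assume i: "i + L \<le> length (?P @ [s] @ x)"
    show "take ?k (drop (Suc i) (?P @ [s] @ x)) \<noteq> x"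
    proof
      assume eq: "take ?k (drop (Suc i) (?P @ [s] @ x)) = x"
      show False
      proof (cases "i < ?k")
        case True
        then have "hd x = (?P @ [s] @ x) ! Suc i"
        proof -
          have "hd x = take ?k (drop (Suc i) (?P @ [s] @ x)) ! 0"
            using x0 by (subst eq) (simp add: hd_conv_nth)
          also have "\<dots> = drop (Suc i) (?P @ [s] @ x) ! 0"
            using x0 by (intro nth_take) simp
          also have "\<dots> = (?P @ [s] @ x) ! (Suc i + 0)"
            using i k by (intro nth_drop) simp
          finally show ?thesis by simp
        qed
        also have "\<dots> = ?P ! Suc i" using True by (subst nth_append) auto
        also have "\<dots> = g" using True by (intro nth_replicate) auto
        finally show False by (simp add: g_def)
      next
        case False
        with i k have "i = ?k" by simp
        then have "take ?k (s # x) = x" using eq by simp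
        then have "s # butlast x = x" using x0
          by (cases x) (auto simp: butlast_conv_take)
        then show False using Cons_butlast_eq_imp_replicate[OF x0] x by blast
      qed
    qed
  qed
  let ?X = "?P @ [c] @ x @ [d] @ []" and ?Y = "?P @ [\<not> c] @ x @ [d] @ []"
  have sgn: "sgn_word ([c] @ x @ [d]) = 1" "sgn_word ([\<not> c] @ x @ [d]) = 0"
    using ne unfolding a[symmetric] by (simp, intro sgn_word_other) (auto simp: a)
  have "score ?X = 1 + score (x @ [d])"
    by (subst score_split_middle[OF k], subst *, subst sgn) simp
  moreover have "score ?Y = score (x @ [d])"
    by (subst score_split_middle[OF k], subst *, subst sgn) simp
  ultimately have "swap_pair ?X ?Y"
    unfolding swap_pair_def using k by (simp flip: k)
  then show ?thesis by blast
qed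

text \<open>The mirror image of \<open>swap_pair_prefix\<close>, for the case that \<open>b\<close> is \<open>[\<not> c] @ x @ [d]\<close>.\<close>
lemma swap_pair_suffix:
  assumes k: "length x + 2 = L" and a: "a = [c] @ x @ [d]" and b: "b = [c'] @ x @ [d']"
    and x: "\<And>e. x \<noteq> replicate (length x) e" and ne: "b \<noteq> [c] @ x @ [\<not> d]"
  shows "\<exists>x y. swap_pair x y"
proof -
  define g where "g = (\<not> last x)"
  let ?k = "length x"
  have x0: "x \<noteq> []" using x[of True] by auto
  let ?P = "replicate (Suc ?k) g"
  have *: "score (x @ [s] @ ?P) = 0" for s
  proof (rule score_eq_0_middle[OF k a b])
    fix i assume i: "i + L \<le> length (x @ [s] @ ?P)"
    show "take ?k (drop (Suc i) (x @ [s] @ ?P)) \<noteq> x"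
    proof
      assume eq: "take ?k (drop (Suc i) (x @ [s] @ ?P)) = x"
      show False
      proof (cases "i = 0")
        case False
        have "last x = take ?k (drop (Suc i) (x @ [s] @ ?P)) ! (?k - 1)"
          using x0 by (subst eq) (simp add: last_conv_nth)
        also have "\<dots> = drop (Suc i) (x @ [s] @ ?P) ! (?k - 1)"
          using x0 by (intro nth_take) simp
        also have "\<dots> = (x @ [s] @ ?P) ! (Suc i + (?k - 1))"
          using i k by (intro nth_drop) simp
        also have "Suc i + (?k - 1) = i + ?k"
          using x0 by (cases x) auto
        also have "(x @ [s] @ ?P) ! (i + ?k) = ?P ! (i - 1)"
          using False by (subst nth_append) (auto simp: nth_append nth_Cons')
        also have "\<dots> = g" using False i k by (intro nth_replicate) auto
        finally show False by (simp add: g_def)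
      next
        case True
        then have "tl x @ [s] = x" using eq x0 by (cases x) auto
        then show False using tl_snoc_eq_imp_replicate[OF x0] x by blast
      qed
    qed
  qed
  let ?X = "[] @ [c] @ x @ [d] @ ?P" and ?Y = "[] @ [c] @ x @ [\<not> d] @ ?P"
  have sgn: "sgn_word ([c] @ x @ [d]) = 1" "sgn_word ([c] @ x @ [\<not> d]) = 0"
    using ne unfolding a[symmetric] by (simp, intro sgn_word_other) (auto simp: a)
  have "score ?X = 1 + score ([c] @ x)"
    by (subst score_split_middle[OF k], subst *, subst sgn) simp
  moreover have "score ?Y = score ([c] @ x)"
    by (subst score_split_middle[OF k], subst *, subst sgn) simp
  ultimately have "swap_pair ?X ?Y"
    unfolding swap_pair_def using k by (simp flip: k)
  then show ?thesis by blast
qed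

text \<open>A run of exactly \<open>k\<close> letters \<open>e\<close> between long runs of the other letter contains \<open>a\<close> once and
\<open>b\<close> never; it is compared with a constant word.\<close>
lemma swap_pair_isolated:
  assumes k: "k + 2 = L" "k \<ge> 1" and a: "a = [\<not> e] @ replicate k e @ [\<not> e]" and b: "b = [c'] @ replicate k e @ [d']"
  shows "\<exists>x y. swap_pair x y"
proof -
  let ?x = "replicate k e" and ?P = "replicate k (\<not> e)"
  have k': "length ?x + 2 = L" using k by simp
  have 0: "score w = 0" if "\<And>i. i + L \<le> length w \<Longrightarrow> \<exists>j<k. w ! (Suc i + j) \<noteq> e" for w
  proof (rule score_eq_0_middle[OF k' a b])
    fix i assume i: "i + L \<le> length w"
    from that[OF this] obtain j where j: "j < k" "w ! (Suc i + j) \<noteq> e" by blast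
    show "take (length ?x) (drop (Suc i) w) \<noteq> ?x"
    proof
      assume "take (length ?x) (drop (Suc i) w) = ?x"
      then have "take (length ?x) (drop (Suc i) w) ! j = ?x ! j" by simp
      then show False using j i k by simp
    qed
  qed
  let ?X = "?P @ [\<not> e] @ ?x @ [\<not> e] @ ?P" and ?Y = "replicate (3 * k + 2) (\<not> e)"
  have "score (?P @ [\<not> e] @ ?x) = 0"
  proof (rule 0)
    fix i assume i: "i + L \<le> length (?P @ [\<not> e] @ ?x)"
    have "(?P @ [\<not> e] @ ?x) ! (Suc i + 0) \<noteq> e" using i k by (auto simp: nth_append)
    then show "\<exists>j<k. (?P @ [\<not> e] @ ?x) ! (Suc i + j) \<noteq> e" using k by (intro exI[of _ 0]) auto
  qed
  moreover have "score (?x @ [\<not> e] @ ?P) = 0"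
  proof (rule 0)
    fix i assume i: "i + L \<le> length (?x @ [\<not> e] @ ?P)"
    have "(?x @ [\<not> e] @ ?P) ! (Suc i + (k - 1)) \<noteq> e" using i k by (auto simp: nth_append nth_Cons')
    then show "\<exists>j<k. (?x @ [\<not> e] @ ?P) ! (Suc i + j) \<noteq> e" using k by (intro exI[of _ "k - 1"]) auto
  qed
  moreover have "sgn_word ([\<not> e] @ ?x @ [\<not> e]) = 1"
    unfolding a[symmetric] by simp
  ultimately have "score ?X = 1"
    by (subst score_split_middle[OF k']) simp
  moreover have "score ?Y = 0"
  proof (rule 0)
    fix i assume i: "i + L \<le> length ?Y"
    have "?Y ! (Suc i + 0) = (\<not> e)" using i k by (intro nth_replicate) auto
    then show "\<exists>j<k. ?Y ! (Suc i + j) \<noteq> e" using k by (intro exI[of _ 0]) auto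
  qed
  moreover have "take (L - 1) ?X = take (L - 1) ?Y" "drop (length ?X - (L - 1)) ?X = drop (length ?Y - (L - 1)) ?Y"
  proof -
    have "L - 1 = k + 1" using k by simp
    moreover have "take (k + 1) ?X = replicate (k + 1) (\<not> e)"
      "drop (length ?X - (k + 1)) ?X = replicate (k + 1) (\<not> e)"
      by (simp_all add: replicate_append_same)
    moreover have "take (k + 1) ?Y = replicate (k + 1) (\<not> e)"
      "drop (length ?Y - (k + 1)) ?Y = replicate (k + 1) (\<not> e)"
      using k by (simp_all only: take_replicate drop_replicate length_replicate)
         (simp_all add: min_def numeral_eq_Suc)
    ultimately show "take (L - 1) ?X = take (L - 1) ?Y"
      "drop (length ?X - (L - 1)) ?X = drop (length ?Y - (L - 1)) ?Y" by simp_all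
  qed
  ultimately have "swap_pair ?X ?Y"
    unfolding swap_pair_def using k by simp
  then show ?thesis by blast
qed

lemma flip: "word_pair L b a"
  using L_pos len_a len_b a_ne_b by unfold_locales auto

lemma score_flip: "word_pair.score L b a w = - score w"
proof -
  interpret F: word_pair L b a by (rule flip)
  show ?thesis by (induction w) (auto simp: F.sgn_word_def sgn_word_def)
qed

lemma swap_pair_flip: "word_pair.swap_pair L b a x y \<longleftrightarrow> swap_pair x y"
proof -
  interpret F: word_pair L b a by (rule flip)
  show ?thesis by (auto simp: F.swap_pair_def swap_pair_def score_flip)
qed

text \<open>Words with different middle parts, words with a non-constant common middle part, and the case that
\<open>a\<close> or \<open>b\<close> is constant are settled by the lemmas above. What remains are the words \<open>c e\<dots>e d\<close> that are not constant: two distinct ones either are reversals of each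
other, or one of them is \<open>e\<dots>e\<close> enclosed in two copies of the other letter.\<close>
theorem swap_pair_exists:
  assumes "b \<noteq> rev a" "b \<noteq> map Not a"
  shows "\<exists>x y. swap_pair x y"
proof -
  interpret F: word_pair L b a by (rule flip)
  have L2: "L \<ge> 2"
  proof (rule ccontr)
    assume "\<not> L \<ge> 2"
    with L_pos len_a len_b have "length a = Suc 0" "length b = Suc 0" by auto
    then obtain s t where "a = [s]" "b = [t]" by (auto simp: length_Suc_conv)
    then show False using a_ne_b assms by auto
  qed
  define k where "k = L - 2"
  have kL: "k + 2 = L" using L2 by (simp add: k_def)
  have shape: "\<exists>c x d. w = [c] @ x @ [d] \<and> length x = k" if "length w = L" for w :: "bool list"
  proof -
    have "length w = Suc (Suc k)" using that kL by simp
    then obtain c u where u: "w = c # u" "length u = Suc k"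
      by (auto simp: length_Suc_conv)
    then obtain x d where "u = x @ [d]" by (cases u rule: rev_cases) auto
    with u show ?thesis by auto
  qed
  obtain c x d where a: "a = [c] @ x @ [d]" and lx: "length x = k" using shape[OF len_a] by blast
  obtain c' x' d' where b: "b = [c'] @ x' @ [d']" and lx': "length x' = k" using shape[OF len_b] by blast
  have k: "length x + 2 = L" using lx kL by simp
  consider e where "a = replicate L e" | e where "b = replicate L e"
    | "x \<noteq> x'" | "x = x'" "\<And>e. x \<noteq> replicate k e" 
    | e where "x = x'" "x = replicate k e" "\<And>e. a \<noteq> replicate L e" "\<And>e. b \<noteq> replicate L e"
    by blast
  then show ?thesis
  proof cases
    case (1 e)
    then show ?thesis using swap_pair_const[of e] assms by simp
  next
    case (2 e)
    have "a \<noteq> replicate L (\<not> e)" using assms(2) 2 by auto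
    then have "\<exists>x y. F.swap_pair x y" using F.swap_pair_const[of e] 2 by simp
    then show ?thesis by (simp add: swap_pair_flip)
  next
    case 3
    then show ?thesis using swap_pair_exchange[OF k a b] lx lx' by simp
  next
    case 4
    then show ?thesis
      using swap_pair_prefix[OF k a, of c' d'] swap_pair_suffix[OF k a, of c' d'] b lx by fastforce
  next
    case (5 e)
    have rep: "[e] @ replicate k e @ [e] = replicate L e"
      by (simp flip: kL add: replicate_append_same)
    have "k \<ge> 1"
    proof (rule ccontr)
      assume "\<not> k \<ge> 1"
      with 5 a b kL have *: "a = [c, d]" "b = [c', d']" "L = 2" by auto
      then have "c \<noteq> d" "c' \<noteq> d'" using 5(3)[of c] 5(4)[of c'] by (auto simp: numeral_2_eq_2)
      then show False using * assms a_ne_b by auto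
    qed
    moreover have "a = [\<not> e] @ replicate k e @ [\<not> e] \<or> b = [\<not> e] @ replicate k e @ [\<not> e]"
    proof (rule ccontr)
      assume "\<not> ?thesis"
      moreover have "a \<noteq> [e] @ replicate k e @ [e]" "b \<noteq> [e] @ replicate k e @ [e]"
        using 5 rep by metis+
      moreover have "a = [c] @ replicate k e @ [d]" "b = [c'] @ replicate k e @ [d']" "rev a = [d] @ replicate k e @ [c]"
        using 5 a b by auto
      ultimately show False using assms a_ne_b by (cases c; cases d; cases c'; cases d'; cases e) auto
    qed
    moreover have "a = [c] @ replicate k e @ [d]" "b = [c'] @ replicate k e @ [d']"
        using 5 a b by auto
    ultimately show ?thesis
      using swap_pair_isolated[OF kL, of e c' d'] F.swap_pair_isolated[OF kL, of e c d, unfolded swap_pair_flip]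
      by blast
  qed
qed

end

section \<open>Decay of the characteristic function\<close>

lemma cmod_1_plus_cis:
  assumes "\<bar>t\<bar> \<le> pi"
  shows "cmod (1 + cis t) \<le> 2 - t\<^sup>2 / 6"
proof -
  have "cis (t / 2) * (cis (- (t / 2)) + cis (t / 2)) = 1 + cis t"
    by (simp add: distrib_left cis_mult)
  moreover have "cis (- (t / 2)) + cis (t / 2) = complex_of_real (2 * cos (t / 2))"
    by (simp add: complex_eq_iff)
  ultimately have "1 + cis t = cis (t / 2) * complex_of_real (2 * cos (t / 2))"
    by simp
  then have "cmod (1 + cis t) = 2 * \<bar>cos (t / 2)\<bar>"
    by (simp only: norm_mult norm_cis norm_of_real abs_mult abs_numeral mult_1)
  also have "\<dots> = 2 * cos (t / 2)"
    using assms by (auto intro!: abs_of_nonneg cos_ge_zero)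
  also have "cos (t / 2) \<le> 1 - t\<^sup>2 / 12"
  proof -
    obtain s where "cos (t / 2) = (\<Sum>m<4. cos_coeff m * (t / 2) ^ m) + (cos (s + 1/2 * real 4 * pi) / fact 4) * (t / 2) ^ 4"
      using Maclaurin_cos_expansion[of "t / 2" 4] by blast
    also have "(\<Sum>m<4. cos_coeff m * (t / 2) ^ m) = 1 - t\<^sup>2 / 8"
    proof -
      have "{..<4::nat} = {0, 1, 2, 3}" by auto
      then show ?thesis by (simp add: cos_coeff_def power2_eq_square)
    qed
    also have "(cos (s + 1/2 * real 4 * pi) / fact 4) * (t / 2) ^ 4 \<le> (1 / fact 4) * (t / 2) ^ 4"
      by (intro mult_right_mono divide_right_mono) auto
    also have "(1 / fact 4) * (t / 2) ^ 4 = t\<^sup>2 * t\<^sup>2 / 384"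
      by (simp add: fact_numeral power4_eq_xxxx power2_eq_square)
    also have "t\<^sup>2 * t\<^sup>2 / 384 \<le> t\<^sup>2 * 16 / 384"
    proof -
      have "\<bar>t\<bar> \<le> 4" using assms pi_less_4 by linarith
      then have "t\<^sup>2 \<le> 4\<^sup>2" by (subst abs_le_square_iff[symmetric]) simp
      then show ?thesis by (intro divide_right_mono mult_left_mono) auto
    qed
    finally show ?thesis by simp
  qed
  finally show ?thesis by simp
qed

lemma norm_cis_diff: "cmod (cis x - cis y) \<le> \<bar>x - y\<bar>"
proof -
  have "cis x - cis y = cis y * (cis (x - y) - 1)"
    by (simp add: right_diff_distrib cis_mult)
  then have "cmod (cis x - cis y) = cmod (cis (x - y) - 1)"
    by (simp add: norm_mult)
  also have "\<dots> = 2 * \<bar>sin ((x - y) / 2)\<bar>"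
    using dist_exp_i_1[of "x - y"] by (simp add: cis_conv_exp)
  also have "\<dots> \<le> \<bar>x - y\<bar>"
    using abs_sin_x_le_abs_x[of "(x - y) / 2"] by simp
  finally show ?thesis .
qed

context word_pair
begin

definition score_char :: "nat \<Rightarrow> bool list \<Rightarrow> real \<Rightarrow> complex" where
  "score_char n v t = avg n (\<lambda>xs. cis (t * of_int (score (v @ xs))))"

lemma score_char_append: "score_char (m + n) v t = avg m (\<lambda>x. score_char n (v @ x) t)"
  by (simp add: score_char_def avg_append)

text \<open>Pair the words whose first block is \<open>x\<close> with those whose first block is \<open>y\<close>. In each pair the scores
differ by one, which produces the factor \<open>1 + cis t\<close> of modulus at most \<open>2 - t\<^sup>2 / 6\<close> instead of \<open>2\<close>; for
all other first blocks the trivial bound is used. The bound must hold for every past \<open>v\<close>, since the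
induction moves the first block into the past.\<close>
lemma score_char_blocks_bound:
  assumes "swap_pair x y" and t: "\<bar>t\<bar> \<le> pi"
  shows "cmod (score_char (k * length x) v t) \<le> (1 - t\<^sup>2 / (6 * 2 ^ length x)) ^ k"
proof (induction k arbitrary: v)
  case 0
  then show ?case by (simp add: score_char_def)
next
  case (Suc k)
  define m where "m = length x"
  define r where "r = 1 - t\<^sup>2 / (6 * 2 ^ m)"
  define G where "G z = score_char (k * m) (v @ z) t" for z
  have G: "cmod (G z) \<le> r ^ k" for z
    using Suc.IH[of "v @ z"] by (simp add: G_def r_def m_def)
  have xy: "x \<in> words m" "y \<in> words m" "x \<noteq> y"
    using assms(1) by (auto simp: m_def words_def swap_pair_def)
  define d where "d = score x - score y"
  have d: "d = 1 \<or> d = - 1" using assms(1) unfolding d_def swap_pair_def by linarith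
  have "cmod (G x + G y) \<le> (2 - t\<^sup>2 / 6) * r ^ k"
  proof -
    have "G x = cis (t * of_int d) * G y"
    proof -
      have "cis (t * of_int (score ((v @ x) @ xs))) = cis (t * of_int d) * cis (t * of_int (score ((v @ y) @ xs)))" for xs
      proof -
        have "t * of_int (score ((v @ x) @ xs)) = t * of_int d + t * of_int (score ((v @ y) @ xs))"
          unfolding append_assoc swap_pair_score[OF assms(1)] of_int_add d_def
          by (simp add: algebra_simps)
        then show ?thesis by (simp add: cis_mult)
      qed
      then show ?thesis by (simp add: G_def score_char_def avg_cmult)
    qed
    then have "G x + G y = (1 + cis (t * of_int d)) * G y" by (simp add: algebra_simps)
    then have "cmod (G x + G y) = cmod (1 + cis (t * of_int d)) * cmod (G y)" by (simp add: norm_mult)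
    also have "\<dots> \<le> (2 - (t * of_int d)\<^sup>2 / 6) * r ^ k"
    proof (intro mult_mono cmod_1_plus_cis G)
      show "\<bar>t * of_int d\<bar> \<le> pi" using d t by auto
      then have "0 \<le> cmod (1 + cis (t * of_int d)) \<and> cmod (1 + cis (t * of_int d)) \<le> 2 - (t * of_int d)\<^sup>2 / 6"
        using cmod_1_plus_cis by simp
      then show "0 \<le> 2 - (t * of_int d)\<^sup>2 / 6" by linarith
    qed auto
    also have "(t * of_int d)\<^sup>2 = t\<^sup>2" using d by auto
    finally show ?thesis .
  qed
  moreover have "cmod (\<Sum>z\<in>words m - {x, y}. G z) \<le> (2 ^ m - 2) * r ^ k"
  proof -
    have "cmod (\<Sum>z\<in>words m - {x, y}. G z) \<le> (\<Sum>z\<in>words m - {x, y}. r ^ k)"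
      by (intro sum_norm_le G)
    also have "\<dots> = real (card (words m - {x, y})) * r ^ k" by simp
    also have "card (words m - {x, y}) = 2 ^ m - 2"
      using xy by (subst card_Diff_subset) auto
    also have "real (2 ^ m - 2) = 2 ^ m - 2"
    proof -
      have "card {x, y} \<le> card (words m)" using xy by (intro card_mono) auto
      then show ?thesis using xy by (simp add: of_nat_diff)
    qed
    finally show ?thesis .
  qed
  moreover have "(\<Sum>z\<in>words m. G z) = (G x + G y) + (\<Sum>z\<in>words m - {x, y}. G z)"
    using xy by (subst sum.subset_diff[of "{x, y}"]) auto
  ultimately have "cmod (\<Sum>z\<in>words m. G z) \<le> (2 - t\<^sup>2 / 6) * r ^ k + (2 ^ m - 2) * r ^ k"
    by (metis (no_types, lifting) add_mono norm_triangle_le)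
  then have "cmod (avg m G) \<le> ((2 - t\<^sup>2 / 6) * r ^ k + (2 ^ m - 2) * r ^ k) / 2 ^ m"
    by (simp add: avg_def norm_divide norm_power divide_right_mono)
  also have "\<dots> = r ^ Suc k"
    by (simp add: r_def field_simps)
  also have "avg m G = score_char (Suc k * m) v t"
    by (simp add: score_char_append G_def[abs_def])
  finally show ?case by (simp add: m_def r_def)
qed

lemma score_char_bound:
  assumes "\<exists>x y. swap_pair x y"
  obtains C c where "C > 0" "c > 0"
    "\<And>n v t. \<bar>t\<bar> \<le> pi \<Longrightarrow> cmod (score_char n v t) \<le> C * exp (- c * t\<^sup>2 * real n)"
proof -
  obtain x y where xy: "swap_pair x y" using assms by blast
  define m where "m = length x"
  have m: "m > 0" using xy L_pos by (auto simp: m_def swap_pair_def)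
  define c where "c = 1 / (6 * 2 ^ m :: real)"
  have c: "c > 0" by (simp add: c_def)
  have "cmod (score_char n v t) \<le> exp (c * pi\<^sup>2) * exp (- (c / real m) * t\<^sup>2 * real n)" if t: "\<bar>t\<bar> \<le> pi" for n v t
  proof -
    let ?k = "n div m"
    have t2: "t\<^sup>2 \<le> pi\<^sup>2" using t by (subst abs_le_square_iff[symmetric]) simp
    \<comment> \<open>Needed to keep the base of the power nonnegative when it is replaced by the exponential.\<close>
    have ct: "c * t\<^sup>2 \<le> 1"
    proof -
      have "pi\<^sup>2 \<le> 4\<^sup>2" using pi_less_4 pi_gt_zero by (intro power_mono) auto
      moreover have "(12::real) \<le> 6 * 2 ^ m" using m by (cases m) auto
      moreover have "t\<^sup>2 \<le> 6 * 2 ^ m"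
        using cmod_1_plus_cis[OF t] norm_ge_zero[of "1 + cis t"] \<open>12 \<le> _\<close> by linarith
      ultimately show ?thesis by (simp add: c_def)
    qed
    have "cmod (score_char n v t) = cmod (avg (n mod m) (\<lambda>u. score_char (?k * m) (v @ u) t))"
      by (subst score_char_append[symmetric]) simp
    also have "\<dots> \<le> (1 - c * t\<^sup>2) ^ ?k"
      using score_char_blocks_bound[OF xy t] by (intro norm_avg_le_const) (simp add: c_def m_def)
    also have "\<dots> \<le> exp (- (c * t\<^sup>2)) ^ ?k"
      using ct exp_ge_add_one_self[of "- (c * t\<^sup>2)"] by (intro power_mono) auto
    also have "\<dots> = exp (- (c * t\<^sup>2 * real ?k))"
      by (simp add: exp_of_nat_mult[symmetric] algebra_simps)
    also have "\<dots> \<le> exp (c * pi\<^sup>2 + - (c / real m) * t\<^sup>2 * real n)"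
    proof -
      have "n = m * ?k + n mod m" "n mod m < m" using m by auto
      then have "n \<le> m * ?k + m" by linarith
      then have "real n \<le> real m * real ?k + real m"
        by (metis of_nat_add of_nat_le_iff of_nat_mult)
      then have "real n / real m \<le> real ?k + 1" using m by (simp add: field_simps)
      then have "c * t\<^sup>2 * (real n / real m) \<le> c * t\<^sup>2 * (real ?k + 1)"
        using c by (intro mult_left_mono) auto
      moreover have "c * t\<^sup>2 \<le> c * pi\<^sup>2" using t2 c by simp
      ultimately show ?thesis by (simp add: algebra_simps)
    qed
    also have "\<dots> = exp (c * pi\<^sup>2) * exp (- (c / real m) * t\<^sup>2 * real n)"
      by (rule exp_add)
    finally show ?thesis .
  qed
  then show thesis
    using that[of "exp (c * pi\<^sup>2)" "c / real m"] c m by simp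
qed

section \<open>The variance\<close>

text \<open>The expected score of all future windows that still involve the past \<open>u\<close>; the windows in \<open>z\<close> alone
contribute zero on average.\<close>
definition drift :: "bool list \<Rightarrow> real" where
  "drift u = avg L (\<lambda>z. of_int (score (u @ z))) - of_int (score u)"

definition svar :: real where
  "svar = (2 + 2 * (drift a - drift b)) / 2 ^ L"

text \<open>Removing the first letter of a word of length \<open>n + 1\<close> leaves a uniform word of length \<open>n\<close> and
removes the window \<open>y\<close> at the front. The covariance of the sign of \<open>y\<close> with the rest of the score is
the average of \<open>sgn_word y * drift y\<close>, because only windows overlapping \<open>y\<close> are correlated with it.
So the second moment grows exactly linearly.\<close>
lemma second_moment_step:
  assumes "n + 1 \<ge> 2 * L"
  shows "avg (Suc n) (\<lambda>w. (of_int (score w))\<^sup>2) = avg n (\<lambda>w. (of_int (score w))\<^sup>2) + svar"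
proof -
  define m where "m = Suc n - L"
  have n: "Suc n = L + m" and m: "m \<ge> L" using assms by (auto simp: m_def)
  let ?s = "\<lambda>y. real_of_int (sgn_word y)"
  let ?q = "\<lambda>w. (real_of_int (score w))\<^sup>2"
  have inner: "avg m (\<lambda>z. ?q (y @ z)) = ?s y * (?s y + 2 * drift y) + avg m (\<lambda>z. ?q (tl (y @ z)))"
    if y: "length y = L" for y
  proof -
    have sc: "score (y @ z) = sgn_word y + score (tl (y @ z))" for z
      using y L_pos by (cases y) auto
    have "avg m (\<lambda>z. of_int (score (y @ z))) = ?s y + drift y"
      using avg_score_stable[of L m y] m y by (simp add: drift_def score_full)
    moreover have "avg m (\<lambda>z. of_int (score (y @ z))) = ?s y + avg m (\<lambda>z. real_of_int (score (tl (y @ z))))"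
      by (simp add: sc avg_add)
    ultimately have d: "avg m (\<lambda>z. real_of_int (score (tl (y @ z)))) = drift y" by simp
    have "avg m (\<lambda>z. ?q (y @ z)) = avg m (\<lambda>z. (?s y)\<^sup>2 + 2 * ?s y * of_int (score (tl (y @ z))) + ?q (tl (y @ z)))"
      by (simp add: sc power2_sum algebra_simps)
    also have "\<dots> = (?s y)\<^sup>2 + 2 * ?s y * drift y + avg m (\<lambda>z. ?q (tl (y @ z)))"
      by (simp only: avg_add avg_const avg_cmult d)
    finally show ?thesis by (simp add: power2_eq_square algebra_simps)
  qed
  have "avg (Suc n) ?q = avg L (\<lambda>y. avg m (\<lambda>z. ?q (y @ z)))"
    by (simp add: n avg_append)
  also have "\<dots> = avg L (\<lambda>y. ?s y * (?s y + 2 * drift y) + avg m (\<lambda>z. ?q (tl (y @ z))))"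
    by (rule avg_cong) (rule inner)
  also have "\<dots> = avg L (\<lambda>y. ?s y * (?s y + 2 * drift y)) + avg (Suc n) (\<lambda>w. ?q (tl w))"
    by (simp only: avg_add n avg_append)
  also have "avg L (\<lambda>y. ?s y * (?s y + 2 * drift y)) = svar"
    by (subst avg_sgn_word) (simp add: svar_def algebra_simps)
  also have "avg (Suc n) (\<lambda>w. ?q (tl w)) = avg n ?q"
    by (rule avg_tl)
  finally show ?thesis by simp
qed

lemma second_moment_limit:
  "(\<lambda>n. avg n (\<lambda>w. (of_int (score w))\<^sup>2) / real n) \<longlonglongrightarrow> svar"
proof -
  define B where "B = avg (2 * L) (\<lambda>w. (of_int (score w))\<^sup>2 :: real)"
  have eq: "avg n (\<lambda>w. (of_int (score w))\<^sup>2) = B + (real n - 2 * real L) * svar" if "n \<ge> 2 * L" for n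
    using that
  proof (induction n rule: dec_induct)
    case base
    then show ?case by (simp add: B_def)
  next
    case (step n)
    then show ?case by (subst second_moment_step) (auto simp: algebra_simps)
  qed
  have "(\<lambda>n. (B + (real n - 2 * real L) * svar) / real n) \<longlonglongrightarrow> svar"
    by real_asymp
  moreover have "\<forall>\<^sub>F n in sequentially. (B + (real n - 2 * real L) * svar) / real n
      = avg n (\<lambda>w. (of_int (score w))\<^sup>2) / real n"
    using eventually_ge_at_top[of "2 * L"] by eventually_elim (simp add: eq)
  ultimately show ?thesis by (rule Lim_transform_eventually)
qed

section \<open>Independent blocks\<close>

primrec block_sum :: "nat \<Rightarrow> nat \<Rightarrow> bool list \<Rightarrow> int" where
  "block_sum K 0 xs = 0"
| "block_sum K (Suc k) xs = score (take K xs) + block_sum K k (drop K xs)"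

text \<open>The part of the score that comes from windows across the cuts between the blocks.\<close>
definition overlap :: "nat \<Rightarrow> nat \<Rightarrow> bool list \<Rightarrow> int" where
  "overlap K k xs = score xs - block_sum K k xs"

definition cross :: "bool list \<Rightarrow> bool list \<Rightarrow> int" where
  "cross x y = score (x @ y) - score x - score y"

lemma avg_cis_block_sum:
  "avg (k * K) (\<lambda>xs. cis (t * of_int (block_sum K k xs))) = score_char K [] t ^ k"
proof (induction k)
  case (Suc k)
  have "avg (Suc k * K) (\<lambda>xs. cis (t * of_int (block_sum K (Suc k) xs)))
      = avg K (\<lambda>x. avg (k * K) (\<lambda>y. cis (t * of_int (score x)) * cis (t * of_int (block_sum K k y))))"
    unfolding mult_Suc avg_append by (rule avg_cong) (simp add: cis_mult algebra_simps)
  also have "\<dots> = score_char K [] t * score_char K [] t ^ k"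
    by (simp add: avg_cmult avg_cmult_right Suc score_char_def)
  finally show ?case by simp
qed simp

lemma cross_take: "cross x y = cross x (take (L - 1) y)"
  using score_append_take[of x y] L_pos by (simp add: cross_def score_short)

lemma cross_abs: "\<bar>cross x y\<bar> \<le> int L"
proof -
  have "cross x y = score (x @ take (L - 1) y) - score x"
    using score_append_take[of x y] by (simp add: cross_def)
  also have "\<bar>\<dots>\<bar> \<le> int (length (take (L - 1) y))"
    by (rule score_append_abs_right)
  also have "\<dots> \<le> int L" by simp
  finally show ?thesis .
qed

lemma avg_cross: "avg m (\<lambda>x. avg (L - 1) (\<lambda>h. of_int (cross x h))) = (0 :: real)"
proof -
  have "avg m (\<lambda>x. avg (L - 1) (\<lambda>h. of_int (cross x h)))
      = avg m (\<lambda>x. avg (L - 1) (\<lambda>h. of_int (score (x @ h)))) - avg m (\<lambda>x. of_int (score x))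
        - (avg (L - 1) (\<lambda>h. of_int (score h)) :: real)"
    by (simp add: cross_def avg_diff)
  also have "\<dots> = 0"
    by (simp only: avg_append[of m "L - 1" "\<lambda>w. of_int (score w)", symmetric] avg_score_0 diff_zero)
  finally show ?thesis .
qed

lemma overlap_Suc:
  "length x = K \<Longrightarrow> overlap K (Suc k) (x @ y) = cross x y + overlap K k y"
  by (simp add: overlap_def cross_def)

text \<open>The first \<open>L - 1\<close> letters influence only windows within the first block, which has at least \<open>2 * L\<close>
letters.\<close>
lemma overlap_head:
  assumes "K \<ge> 2 * L" "k \<ge> 1" "length h = L - 1" "length h' = L - 1" "length h + length z \<ge> K"
  shows "overlap K k (h @ z) = overlap K k (h' @ z)"
proof -
  obtain k' where k': "k = Suc k'" using assms(2) by (cases k) auto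
  define m where "m = take (K - (L - 1)) z"
  define w where "w = drop (K - (L - 1)) z"
  have z: "z = m @ w" by (simp add: m_def w_def)
  have m: "length m = K - (L - 1)" using assms by (simp add: m_def)
  have "overlap K k (h @ z) = score (drop (K - (L - 1) - (L - 1)) m @ w) - block_sum K k' w"
    if "length h = L - 1" for h
  proof -
    have l: "length (h @ m) = K" using that m assms(1) by simp
    have "score (h @ z) = score (h @ m) + score (drop (K - (L - 1)) (h @ m) @ w)"
      unfolding z append_assoc[symmetric] using score_append_drop[of "h @ m" w, unfolded l] .
    moreover have "drop (K - (L - 1)) (h @ m) = drop (K - (L - 1) - (L - 1)) m"
      using that assms(1) by simp
    moreover have "take K (h @ z) = h @ m" "drop K (h @ z) = w"
      using l unfolding z append_assoc[symmetric] by (simp_all del: append_assoc)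
    ultimately show ?thesis by (simp only: overlap_def k' block_sum.simps)
  qed
  then show ?thesis using assms by simp
qed

text \<open>The windows across the first cut involve at most the first \<open>L - 1\<close> letters of \<open>y\<close>, on which
the windows across the later cuts do not depend. Both contributions are thus independent, and the first
one has mean zero.\<close>
lemma avg_cross_overlap:
  assumes "K \<ge> 2 * L"
  shows "avg K (\<lambda>x. avg (k * K) (\<lambda>y. of_int (cross x y) * of_int (overlap K k y))) = (0 :: real)"
proof (cases k)
  case 0
  then show ?thesis by (simp add: overlap_def)
next
  case (Suc k')
  define j where "j = k * K - (L - 1)"
  have j: "k * K = (L - 1) + j" "L - 1 + j \<ge> K" using assms by (auto simp: j_def Suc)
  define \<rho> where "\<rho> = avg j (\<lambda>z. real_of_int (overlap K k (replicate (L - 1) False @ z)))"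
  have "avg (k * K) (\<lambda>y. of_int (cross x y) * of_int (overlap K k y))
      = avg (L - 1) (\<lambda>h. of_int (cross x h)) * \<rho>" for x
  proof -
    have "avg (k * K) (\<lambda>y. of_int (cross x y) * real_of_int (overlap K k y))
      = avg (L - 1) (\<lambda>h. avg j (\<lambda>z. of_int (cross x h) * of_int (overlap K k (replicate (L - 1) False @ z))))"
      unfolding j(1) avg_append
    proof (intro avg_cong)
      fix h z :: "bool list" assume hz: "length h = L - 1" "length z = j"
      have "cross x (h @ z) = cross x h"
        using hz cross_take[of x "h @ z"] by simp
      moreover have "overlap K k (h @ z) = overlap K k (replicate (L - 1) False @ z)"
        using hz j by (intro overlap_head assms) (auto simp: Suc)
      ultimately show "of_int (cross x (h @ z)) * real_of_int (overlap K k (h @ z))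
         = of_int (cross x h) * of_int (overlap K k (replicate (L - 1) False @ z))" by simp
    qed
    also have "\<dots> = avg (L - 1) (\<lambda>h. of_int (cross x h)) * \<rho>"
      by (simp only: avg_cmult avg_cmult_right \<rho>_def)
    finally show ?thesis .
  qed
  then have "avg K (\<lambda>x. avg (k * K) (\<lambda>y. of_int (cross x y) * of_int (overlap K k y)))
      = avg K (\<lambda>x. avg (L - 1) (\<lambda>h. of_int (cross x h)) * \<rho>)" by (simp only:)
  then show ?thesis by (simp only: avg_cmult_right avg_cross mult_zero_left)
qed

lemma avg_overlap_sq:
  assumes "K \<ge> 2 * L"
  shows "avg (k * K) (\<lambda>xs. (of_int (overlap K k xs))\<^sup>2) \<le> real k * (real L)\<^sup>2"
proof (induction k)
  case 0
  then show ?case by (simp add: overlap_def)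
next
  case (Suc k)
  have "avg (Suc k * K) (\<lambda>xs. (real_of_int (overlap K (Suc k) xs))\<^sup>2)
    = avg K (\<lambda>x. avg (k * K) (\<lambda>y. (of_int (cross x y))\<^sup>2 + 2 * (of_int (cross x y) * of_int (overlap K k y))
         + (of_int (overlap K k y))\<^sup>2))"
    unfolding mult_Suc avg_append
    by (intro avg_cong) (simp add: overlap_Suc power2_sum algebra_simps)
  also have "\<dots> = avg K (\<lambda>x. avg (k * K) (\<lambda>y. (of_int (cross x y))\<^sup>2))
      + avg (k * K) (\<lambda>y. (real_of_int (overlap K k y))\<^sup>2)"
    by (simp only: avg_add avg_cmult avg_cross_overlap[OF assms] avg_const mult_zero_right add_0_right)
  also have "\<dots> \<le> avg K (\<lambda>x. avg (k * K) (\<lambda>y. (real L)\<^sup>2)) + real k * (real L)\<^sup>2"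
  proof (intro add_mono avg_mono Suc)
    fix x y
    have "\<bar>real_of_int (cross x y)\<bar> \<le> \<bar>real L\<bar>"
      using cross_abs[of x y] by (simp flip: of_int_abs)
    then show "(real_of_int (cross x y))\<^sup>2 \<le> (real L)\<^sup>2" by (simp only: abs_le_square_iff)
  qed
  finally show ?case by (simp add: algebra_simps)
qed

lemma avg_overlap_abs:
  assumes "K \<ge> 2 * L"
  shows "avg (k * K) (\<lambda>xs. \<bar>of_int (overlap K k xs)\<bar>) \<le> sqrt (real k) * real L"
  using avg_overlap_sq[OF assms, of k] by (intro avg_abs_le_sqrt) (auto simp: power_mult_distrib)

text \<open>The past, the remainder of fewer than \<open>K\<close> letters and the windows across the cuts are neglected.
The mean absolute value of the last contribution is bounded by its standard deviation, which grows only
with the square root of the number of cuts.\<close>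
lemma score_char_approx_power:
  assumes "K \<ge> 2 * L"
  shows "cmod (score_char n v t - score_char K [] t ^ (n div K))
    \<le> \<bar>t\<bar> * (real (length v) + real K + sqrt (real (n div K)) * real L)"
proof -
  let ?k = "n div K"
  have K: "K > 0" using assms L_pos by simp
  have main: "cmod (score_char (?k * K) u t - score_char K [] t ^ ?k) \<le> \<bar>t\<bar> * (real (length u) + sqrt (real ?k) * real L)"
    for u
  proof -
    have "score_char (?k * K) u t - score_char K [] t ^ ?k = avg (?k * K)
       (\<lambda>xs. cis (t * of_int (score (u @ xs))) - cis (t * of_int (block_sum K ?k xs)))"
      by (simp only: score_char_def[of "?k * K"] avg_cis_block_sum[symmetric] avg_diff)
    also have "cmod \<dots> \<le> avg (?k * K) 
       (\<lambda>xs. cmod (cis (t * of_int (score (u @ xs))) - cis (t * of_int (block_sum K ?k xs))))"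
      by (rule norm_avg_le)
    also have "\<dots> \<le> avg (?k * K) (\<lambda>xs. \<bar>t\<bar> * (real (length u) + \<bar>of_int (overlap K ?k xs)\<bar>))"
    proof (intro avg_mono)
      fix xs
      have "\<bar>score (u @ xs) - block_sum K ?k xs\<bar> \<le> int (length u) + \<bar>overlap K ?k xs\<bar>"
        using score_append_abs_left[of u xs] by (simp add: overlap_def)
      then have *: "\<bar>real_of_int (score (u @ xs) - block_sum K ?k xs)\<bar> \<le> real (length u) + \<bar>of_int (overlap K ?k xs)\<bar>"
        by linarith
      have "cmod (cis (t * of_int (score (u @ xs))) - cis (t * of_int (block_sum K ?k xs)))
         \<le> \<bar>t * of_int (score (u @ xs)) - t * of_int (block_sum K ?k xs)\<bar>"
        by (rule norm_cis_diff)
      also have "\<dots> = \<bar>t\<bar> * \<bar>real_of_int (score (u @ xs) - block_sum K ?k xs)\<bar>"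
        by (simp add: abs_mult[symmetric] right_diff_distrib)
      also have "\<dots> \<le> \<bar>t\<bar> * (real (length u) + \<bar>of_int (overlap K ?k xs)\<bar>)"
        using * by (intro mult_left_mono) auto
      finally show "cmod (cis (t * of_int (score (u @ xs))) - cis (t * of_int (block_sum K ?k xs)))
         \<le> \<bar>t\<bar> * (real (length u) + \<bar>of_int (overlap K ?k xs)\<bar>)" .
    qed
    also have "\<dots> = \<bar>t\<bar> * (real (length u) + avg (?k * K) (\<lambda>xs. \<bar>of_int (overlap K ?k xs)\<bar>))"
      by (simp only: avg_cmult avg_add avg_const)
    also have "\<dots> \<le> \<bar>t\<bar> * (real (length u) + sqrt (real ?k) * real L)"
      using avg_overlap_abs[OF assms, of ?k] by (intro mult_left_mono add_left_mono) auto
    finally show ?thesis .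
  qed
  have "score_char n v t - score_char K [] t ^ ?k
      = avg (n mod K) (\<lambda>u. score_char (?k * K) (v @ u) t - score_char K [] t ^ ?k)"
    by (simp add: avg_diff flip: score_char_append)
  also have "cmod \<dots> \<le> \<bar>t\<bar> * (real (length v) + real K + sqrt (real ?k) * real L)"
  proof (rule norm_avg_le_const)
    fix u :: "bool list" assume u: "length u = n mod K"
    have "n mod K < K" using K by simp
    then have "real (length (v @ u)) \<le> real (length v) + real K"
      using u by simp
    then have "\<bar>t\<bar> * (real (length (v @ u)) + sqrt (real ?k) * real L) \<le> \<bar>t\<bar> * (real (length v) + real K + sqrt (real ?k) * real L)"
      by (intro mult_left_mono) auto
    with main[of "v @ u"]
    show "cmod (score_char (?k * K) (v @ u) t - score_char K [] t ^ ?k)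
      \<le> \<bar>t\<bar> * (real (length v) + real K + sqrt (real ?k) * real L)" by linarith
  qed
  finally show ?thesis .
qed

end

section \<open>Gaussian limit of the characteristic function\<close>

lemma cis_approx: "cmod (cis x - (1 + \<i> * x - x\<^sup>2 / 2)) \<le> \<bar>x\<bar> ^ 3 / 6"
proof -
  have "(\<Sum>k\<le>2. (\<i> * x) ^ k / fact k) = 1 + \<i> * x - x\<^sup>2 / 2"
  proof -
    have "{..2::nat} = {0, 1, 2}" by auto
    then show ?thesis by (simp add: power_mult_distrib)
  qed
  then show ?thesis
    using iexp_approx1[of x 2] by (simp add: cis_conv_exp numeral_3_eq_3 fact_numeral)
qed

lemma exp_neg_approx:
  assumes "(y::real) \<ge> 0" shows "\<bar>exp (- y) - (1 - y)\<bar> \<le> y\<^sup>2"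
proof -
  have "exp (- y) \<ge> 1 - y" using exp_ge_add_one_self[of "- y"] by simp
  moreover have "exp (- y) \<le> 1 / (1 + y)"
    using assms exp_ge_add_one_self[of y] by (simp add: exp_minus inverse_eq_divide frac_le)
  moreover have "1 / (1 + y) \<le> 1 - y + y\<^sup>2"
    using assms by (simp add: field_simps power2_eq_square)
  ultimately show ?thesis by simp
qed

lemma tendsto_div_ratio:
  assumes "K > 0"
  shows "(\<lambda>n. real (n div K) / real n) \<longlonglongrightarrow> 1 / real K"
proof -
  have "(\<lambda>n. of_int \<lfloor>real n / real K\<rfloor> / real n) \<longlonglongrightarrow> inverse (real K)"
    using assms by real_asymp
  moreover have "of_int \<lfloor>real n / real K\<rfloor> = real (n div K)" for n
    by (simp add: floor_divide_of_nat_eq)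
  ultimately show ?thesis by (simp add: inverse_eq_divide)
qed

context word_pair
begin

lemma norm_score_char_le_1: "cmod (score_char n v t) \<le> 1"
  unfolding score_char_def by (intro norm_avg_le_const) simp

lemma score_char_taylor:
  fixes K :: nat
  defines "V \<equiv> avg K (\<lambda>w. (of_int (score w))\<^sup>2 :: real)"
  shows "cmod (score_char K [] t - of_real (1 - V * t\<^sup>2 / 2)) \<le> (\<bar>t\<bar> * real K) ^ 3 / 6"
proof -
  let ?x = "\<lambda>w. t * real_of_int (score w)"

  have "avg K (\<lambda>w. 1 + (\<i> * t) * complex_of_real (of_int (score w)) - complex_of_real (t\<^sup>2 / 2) * complex_of_real ((of_int (score w))\<^sup>2))
      = of_real (1 - V * t\<^sup>2 / 2)"
    unfolding avg_diff avg_add avg_const avg_cmult avg_of_real avg_score_0 V_def[symmetric] by simp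
  then have "score_char K [] t - of_real (1 - V * t\<^sup>2 / 2)
      = avg K (\<lambda>w. cis (?x w) - (1 + \<i> * ?x w - (?x w)\<^sup>2 / 2))"
    by (simp add: score_char_def avg_diff power_mult_distrib mult.assoc)
  also have "cmod \<dots> \<le> (\<bar>t\<bar> * real K) ^ 3 / 6"
  proof (rule norm_avg_le_const)
    fix w :: "bool list" assume "length w = K"
    then have "\<bar>real_of_int (score w)\<bar> \<le> real K" using score_abs[of w] by linarith
    then have "\<bar>?x w\<bar> \<le> \<bar>t\<bar> * real K" by (simp add: abs_mult mult_left_mono)
    then have "\<bar>?x w\<bar> ^ 3 \<le> (\<bar>t\<bar> * real K) ^ 3" by (intro power_mono) auto
    with cis_approx[of "?x w"]
    show "cmod (cis (?x w) - (1 + \<i> * ?x w - (?x w)\<^sup>2 / 2)) \<le> (\<bar>t\<bar> * real K) ^ 3 / 6"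
      by linarith
  qed
  finally show ?thesis .
qed

lemma score_char_power_limit:
  fixes t :: real and K :: nat
  assumes "K > 0"
  defines "V \<equiv> avg K (\<lambda>w. (of_int (score w))\<^sup>2 :: real)"
  shows "(\<lambda>n. score_char K [] (t / sqrt (real n)) ^ (n div K)) \<longlonglongrightarrow> of_real (exp (- (V * t\<^sup>2 / (2 * real K))))"
proof -
  have V: "V \<ge> 0" unfolding V_def using avg_mono[of K "\<lambda>_. 0"] by simp
  define w where "w n = complex_of_real (exp (- (V * (t / sqrt (real n))\<^sup>2 / 2)))" for n :: nat
  have "(\<lambda>n. score_char K [] (t / sqrt (real n)) ^ (n div K) - w n ^ (n div K)) \<longlonglongrightarrow> 0"
  proof (rule Lim_null_comparison)
    show "(\<lambda>n. real n * ((\<bar>t\<bar> * real K) ^ 3 / 6 / (real n * sqrt (real n)) + (V * t\<^sup>2 / 2)\<^sup>2 / (real n)\<^sup>2)) \<longlonglongrightarrow> 0"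
      by real_asymp
    show "\<forall>\<^sub>F n in sequentially. cmod (score_char K [] (t / sqrt (real n)) ^ (n div K) - w n ^ (n div K))
       \<le> real n * ((\<bar>t\<bar> * real K) ^ 3 / 6 / (real n * sqrt (real n)) + (V * t\<^sup>2 / 2)\<^sup>2 / (real n)\<^sup>2)"
      using eventually_gt_at_top[of 0]
    proof eventually_elim
      case (elim n)
      let ?\<theta> = "t / sqrt (real n)"
      have w1: "cmod (w n) \<le> 1" using V by (simp add: w_def)
      have th2: "?\<theta>\<^sup>2 = t\<^sup>2 / real n" using elim by (simp add: power_divide)
      have "cmod (score_char K [] ?\<theta> ^ (n div K) - w n ^ (n div K))
         \<le> real (n div K) * cmod (score_char K [] ?\<theta> - w n)"
        by (rule norm_power_diff[OF norm_score_char_le_1 w1])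
      also have "\<dots> \<le> real n * ((\<bar>t\<bar> * real K) ^ 3 / 6 / (real n * sqrt (real n)) + (V * t\<^sup>2 / 2)\<^sup>2 / (real n)\<^sup>2)"
      proof (intro mult_mono)
        have "cmod (score_char K [] ?\<theta> - w n)
           \<le> cmod (score_char K [] ?\<theta> - of_real (1 - V * ?\<theta>\<^sup>2 / 2)) + cmod (w n - of_real (1 - V * ?\<theta>\<^sup>2 / 2))"
          using norm_triangle_ineq4[of "score_char K [] ?\<theta> - of_real (1 - V * ?\<theta>\<^sup>2 / 2)" "w n - of_real (1 - V * ?\<theta>\<^sup>2 / 2)"]
          by simp
        also have "\<dots> \<le> (\<bar>?\<theta>\<bar> * real K) ^ 3 / 6 + (V * ?\<theta>\<^sup>2 / 2)\<^sup>2"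
        proof (rule add_mono)
          show "cmod (score_char K [] ?\<theta> - of_real (1 - V * ?\<theta>\<^sup>2 / 2)) \<le> (\<bar>?\<theta>\<bar> * real K) ^ 3 / 6"
            unfolding V_def by (rule score_char_taylor)
          show "cmod (w n - of_real (1 - V * ?\<theta>\<^sup>2 / 2)) \<le> (V * ?\<theta>\<^sup>2 / 2)\<^sup>2"
            unfolding w_def of_real_diff[symmetric] norm_of_real
            using V by (intro exp_neg_approx) auto
        qed
        also have "(\<bar>?\<theta>\<bar> * real K) ^ 3 / 6 = (\<bar>t\<bar> * real K) ^ 3 / 6 / (real n * sqrt (real n))"
        proof -
          have "sqrt (real n) ^ 3 = real n * sqrt (real n)"
            by (simp add: power3_eq_cube)
          then show ?thesis by (simp add: power_mult_distrib power_divide abs_divide)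
        qed
        also have "(V * ?\<theta>\<^sup>2 / 2)\<^sup>2 = (V * t\<^sup>2 / 2)\<^sup>2 / (real n)\<^sup>2"
          unfolding th2 by (simp add: power_divide power_mult_distrib)
        finally show "cmod (score_char K [] ?\<theta> - w n) \<le> (\<bar>t\<bar> * real K) ^ 3 / 6 / (real n * sqrt (real n)) + (V * t\<^sup>2 / 2)\<^sup>2 / (real n)\<^sup>2" .
      qed auto
      finally show ?case .
    qed
  qed
  moreover have "(\<lambda>n. w n ^ (n div K)) \<longlonglongrightarrow> of_real (exp (- (V * t\<^sup>2 / (2 * real K))))"
  proof -
    have "(\<lambda>n. complex_of_real (exp (- (V * t\<^sup>2 / 2 * (real (n div K) / real n))))) \<longlonglongrightarrow> of_real (exp (- (V * t\<^sup>2 / 2 * (1 / real K))))"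
      by (intro tendsto_intros tendsto_div_ratio assms)
    moreover have "w n ^ (n div K) = complex_of_real (exp (- (V * t\<^sup>2 / 2 * (real (n div K) / real n))))" for n
      by (simp add: w_def power_divide mult_ac flip: of_real_power exp_of_nat_mult)
    ultimately show ?thesis by simp
  qed
  ultimately show ?thesis using tendsto_add by fastforce
qed

text \<open>For fixed \<open>K\<close> the block approximation is off by at most \<open>\<bar>t\<bar> * L / sqrt K\<close> in the limit \<open>n \<longlonglongrightarrow> \<infinity>\<close>, and its
own limit is Gaussian with the variance per letter of a block of length \<open>K\<close>, which tends to \<open>svar\<close>.\<close>
theorem score_char_limit:
  "(\<lambda>n. score_char n v (t / sqrt (real n))) \<longlonglongrightarrow> of_real (exp (- (svar * t\<^sup>2 / 2)))"
proof (rule tendstoI)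
  fix e :: real assume e: "e > 0"
  define V where "V K = avg K (\<lambda>w. (of_int (score w))\<^sup>2 :: real)" for K
  have "(\<lambda>K. complex_of_real (exp (- (V K / real K * (t\<^sup>2 / 2))))) \<longlonglongrightarrow> of_real (exp (- (svar * (t\<^sup>2 / 2))))"
    unfolding V_def by (intro tendsto_intros second_moment_limit)
  then have "\<forall>\<^sub>F K in sequentially. dist (complex_of_real (exp (- (V K / real K * (t\<^sup>2 / 2))))) (of_real (exp (- (svar * (t\<^sup>2 / 2))))) < e / 4"
    using e by (intro tendstoD) auto
  moreover have "(\<lambda>K. \<bar>t\<bar> * real L / sqrt (real K)) \<longlonglongrightarrow> 0" by real_asymp
  then have "\<forall>\<^sub>F K in sequentially. \<bar>t\<bar> * real L / sqrt (real K) < e / 4"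
    using e by (intro order_tendstoD) auto
  ultimately have "\<forall>\<^sub>F K in sequentially. K \<ge> 2 * L
     \<and> dist (complex_of_real (exp (- (V K / real K * (t\<^sup>2 / 2))))) (of_real (exp (- (svar * (t\<^sup>2 / 2))))) < e / 4
     \<and> \<bar>t\<bar> * real L / sqrt (real K) < e / 4"
    using eventually_ge_at_top[of "2 * L"] by eventually_elim auto
  then obtain K where K: "K \<ge> 2 * L"
    and K1: "dist (complex_of_real (exp (- (V K / real K * (t\<^sup>2 / 2))))) (of_real (exp (- (svar * (t\<^sup>2 / 2))))) < e / 4"
    and K2: "\<bar>t\<bar> * real L / sqrt (real K) < e / 4"
    by (auto simp: eventually_sequentially)
  have K0: "K > 0" using K L_pos by simp
  have "\<forall>\<^sub>F n in sequentially. dist (score_char K [] (t / sqrt (real n)) ^ (n div K)) (of_real (exp (- (V K * t\<^sup>2 / (2 * real K))))) < e / 4"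
    using score_char_power_limit[OF K0, of t] e unfolding V_def by (intro tendstoD) auto
  moreover have "(\<lambda>n. \<bar>t\<bar> / sqrt (real n) * (real (length v) + real K)) \<longlonglongrightarrow> 0" by real_asymp
  then have "\<forall>\<^sub>F n in sequentially. \<bar>t\<bar> / sqrt (real n) * (real (length v) + real K) < e / 4"
    using e by (intro order_tendstoD) auto
  ultimately show "\<forall>\<^sub>F n in sequentially. dist (score_char n v (t / sqrt (real n))) (of_real (exp (- (svar * t\<^sup>2 / 2)))) < e"
    using eventually_gt_at_top[of 0]
  proof eventually_elim
    case (elim n)
    let ?\<theta> = "t / sqrt (real n)"
    have "sqrt (real (n div K)) \<le> sqrt (real n) / sqrt (real K)"
      using of_nat_div_le_of_nat[of n K, where 'a = real] by (simp flip: real_sqrt_divide)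
    then have "\<bar>?\<theta>\<bar> * (sqrt (real (n div K)) * real L) \<le> \<bar>?\<theta>\<bar> * (sqrt (real n) / sqrt (real K) * real L)"
      by (intro mult_left_mono mult_right_mono) auto
    also have "\<dots> = \<bar>t\<bar> * real L / sqrt (real K)" using elim(3) by (simp add: abs_divide)
    finally have 1: "\<bar>?\<theta>\<bar> * (sqrt (real (n div K)) * real L) < e / 4" using K2 by linarith
    have "dist (score_char n v ?\<theta>) (score_char K [] ?\<theta> ^ (n div K))
       \<le> \<bar>?\<theta>\<bar> * (real (length v) + real K) + \<bar>?\<theta>\<bar> * (sqrt (real (n div K)) * real L)"
      using score_char_approx_power[OF K, of n v ?\<theta>] by (simp add: dist_norm distrib_left)
    also have "\<dots> < e / 4 + e / 4"
      using 1 elim(2) by (intro add_strict_mono) (auto simp: abs_divide)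
    finally have 2: "dist (score_char n v ?\<theta>) (score_char K [] ?\<theta> ^ (n div K)) < e / 4 + e / 4" .
    have eq: "V K * t\<^sup>2 / (2 * real K) = V K / real K * (t\<^sup>2 / 2)" "svar * t\<^sup>2 / 2 = svar * (t\<^sup>2 / 2)"
      by simp_all
    have "dist (score_char n v ?\<theta>) (of_real (exp (- (svar * t\<^sup>2 / 2))))
      \<le> dist (score_char n v ?\<theta>) (score_char K [] ?\<theta> ^ (n div K))
        + dist (score_char K [] ?\<theta> ^ (n div K)) (of_real (exp (- (V K * t\<^sup>2 / (2 * real K)))))
        + dist (complex_of_real (exp (- (V K * t\<^sup>2 / (2 * real K))))) (of_real (exp (- (svar * t\<^sup>2 / 2))))"
      by (rule order_trans[OF dist_triangle add_right_mono[OF dist_triangle]])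
    also have "\<dots> < (e / 4 + e / 4) + e / 4 + e / 4"
      using 2 elim(1) K1 unfolding eq by linarith
    finally show ?case by simp
  qed
qed

end

section \<open>Fourier inversion\<close>

text \<open>Orthogonality of characters, already rescaled by the factor \<open>c\<close> that will be \<open>sqrt n\<close>.\<close>
lemma has_bochner_integral_cis_period:
  fixes c :: real and s :: int
  assumes c: "c > 0"
  shows "has_bochner_integral lborel (\<lambda>t. indicator {- (pi * c)..pi * c} t *\<^sub>R cis (t / c * of_int s))
           (of_real (2 * pi * c * of_bool (s = 0)))"
proof (cases "s = 0")
  case True
  have "has_bochner_integral lborel (\<lambda>t. indicator {- (pi * c)..pi * c} t *\<^sub>R (1::complex))
    (complex_of_real (pi * c) - complex_of_real (- (pi * c)))"
  proof (rule has_bochner_integral_FTC_Icc)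
    show "(complex_of_real has_vector_derivative 1) (at x within {- (pi * c)..pi * c})" for x
      using has_vector_derivative_of_real[OF DERIV_ident] by simp
  qed (use c in auto)
  then show ?thesis using True by (simp add: mult.assoc)
next
  case False
  let ?F = "\<lambda>t. cis (t / c * of_int s) * (c / (\<i> * of_int s))"
  have "has_bochner_integral lborel (\<lambda>t. indicator {- (pi * c)..pi * c} t *\<^sub>R cis (t / c * of_int s)) 
      (?F (pi * c) - ?F (- (pi * c)))"
  proof (rule has_bochner_integral_FTC_Icc)
    show "continuous_on {- (pi * c)..pi * c} (\<lambda>t. cis (t / c * of_int s))"
      unfolding cis_conv_exp using c by (intro continuous_intros) auto
    fix x
    have "((\<lambda>z. exp (\<i> * (z / c * of_int s)) * (c / (\<i> * of_int s))) has_field_derivative exp (\<i> * (of_real x / c * of_int s))) (at (of_real x))"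
      using c False by (auto intro!: derivative_eq_intros) (simp add: mult_ac)
    then show "(?F has_vector_derivative cis (x / c * of_int s)) (at x within {- (pi * c)..pi * c})"
      using has_vector_derivative_real_field[of "\<lambda>z. exp (\<i> * (z / c * of_int s)) * (c / (\<i> * of_int s))"]
      by (simp add: cis_conv_exp)
  qed (use c in auto)
  moreover have "cis (pi * of_int s) = cis (- (pi * of_int s))"
  proof -
    have "cis (pi * of_int s) = cis (2 * pi * of_int s) * cis (- (pi * of_int s))"
      by (simp add: cis_mult mult.assoc)
    also have "cis (2 * pi * of_int s) = 1"
      by (intro cis_multiple_2pi) auto
    finally show ?thesis by simp
  qed
  ultimately show ?thesis using False c by simp
qed

lemma has_bochner_integral_gauss:
  fixes s :: real
  assumes s: "s > 0"
  shows "has_bochner_integral lborel (\<lambda>t. exp (- (s * t\<^sup>2 / 2))) (sqrt (2 * pi / s))"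
proof -
  have "has_bochner_integral lborel (\<lambda>t. sqrt (2 * pi / s) * normal_density 0 (1 / sqrt s) t) (sqrt (2 * pi / s) * 1)"
    using s by (intro has_bochner_integral_mult_right) (auto simp: has_bochner_integral_iff)
  moreover have "sqrt (2 * pi / s) * normal_density 0 (1 / sqrt s) t = exp (- (s * t\<^sup>2 / 2))" for t
    using s by (simp add: normal_density_def power_divide field_simps)
  ultimately show ?thesis by simp
qed

context word_pair
begin

lemma has_bochner_integral_score_char:
  assumes c: "c > 0"
  shows "has_bochner_integral lborel (\<lambda>t. indicator {- (pi * c)..pi * c} t *\<^sub>R score_char n v (t / c))
           (of_real (2 * pi * c * avg n (\<lambda>xs. of_bool (score (v @ xs) = 0))))"
proof -
  have "has_bochner_integral lborel (\<lambda>t. (\<Sum>xs\<in>words n. indicator {- (pi * c)..pi * c} t *\<^sub>R cis (t / c * of_int (score (v @ xs)))) / 2 ^ n)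
      ((\<Sum>xs\<in>words n. of_real (2 * pi * c * of_bool (score (v @ xs) = 0))) / 2 ^ n)"
    by (intro has_bochner_integral_divide_zero has_bochner_integral_sum has_bochner_integral_cis_period c)
  moreover have "(\<Sum>xs\<in>words n. indicator {- (pi * c)..pi * c} t *\<^sub>R cis (t / c * of_int (score (v @ xs)))) / 2 ^ n
      = indicator {- (pi * c)..pi * c} t *\<^sub>R score_char n v (t / c)" for t
    by (simp only: score_char_def avg_def scaleR_sum_right scaleR_conv_of_real times_divide_eq_right sum_distrib_left)
  moreover have "(\<Sum>xs\<in>words n. complex_of_real (2 * pi * c * of_bool (score (v @ xs) = 0))) / 2 ^ n
      = of_real (2 * pi * c * avg n (\<lambda>xs. of_bool (score (v @ xs) = 0)))"
    unfolding avg_def by (simp only: sum_distrib_left times_divide_eq_right of_real_sum of_real_divide of_real_power of_real_numeral)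
  ultimately show ?thesis by (simp only:)
qed

text \<open>The Gaussian limit of the characteristic function inherits the bound \<open>C * exp (- c * t\<^sup>2)\<close>, so it
cannot be constant or growing in \<open>t\<close>.\<close>
lemma svar_pos:
  assumes "\<exists>x y. swap_pair x y"
  shows "svar > 0"
proof (rule ccontr)
  assume neg: "\<not> svar > 0"
  obtain C c where C: "C > 0" and c: "c > 0"
    and bound: "\<And>n v t. \<bar>t\<bar> \<le> pi \<Longrightarrow> cmod (score_char n v t) \<le> C * exp (- c * t\<^sup>2 * real n)"
    using score_char_bound[OF assms] by blast
  \<comment> \<open>At this \<open>t\<close> the bound is \<open>C * exp (- C) < 1\<close>, while the limit is at least \<open>1\<close> if \<open>svar\<close> is not positive.\<close>
  define t where "t = sqrt (C / c)"
  have t2: "c * t\<^sup>2 = C" using C c by (simp add: t_def)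
  have "(\<lambda>n. cmod (score_char n [] (t / sqrt (real n)))) \<longlonglongrightarrow> cmod (of_real (exp (- (svar * t\<^sup>2 / 2))))"
    by (intro tendsto_norm score_char_limit)
  moreover have "(\<lambda>n. \<bar>t\<bar> / sqrt (real n)) \<longlonglongrightarrow> 0" by real_asymp
  then have "\<forall>\<^sub>F n in sequentially. \<bar>t\<bar> / sqrt (real n) < pi"
    using pi_gt_zero by (intro order_tendstoD) auto
  then have "\<forall>\<^sub>F n in sequentially. cmod (score_char n [] (t / sqrt (real n))) \<le> C * exp (- C)"
    using eventually_gt_at_top[of 0]
  proof eventually_elim
    case (elim n)
    then have "cmod (score_char n [] (t / sqrt (real n))) \<le> C * exp (- c * (t / sqrt (real n))\<^sup>2 * real n)"
      by (intro bound) (simp add: abs_divide)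
    also have "- c * (t / sqrt (real n))\<^sup>2 * real n = - C"
      using elim t2 by (simp add: power_divide)
    finally show ?case .
  qed
  ultimately have "cmod (of_real (exp (- (svar * t\<^sup>2 / 2)))) \<le> C * exp (- C)"
    by (intro tendsto_upperbound) auto
  moreover have "1 \<le> exp (- (svar * t\<^sup>2 / 2))"
    using neg by (auto simp: mult_nonpos_nonneg)
  ultimately have "1 \<le> C * exp (- C)" unfolding norm_of_real by linarith
  then have "exp C \<le> C" by (simp add: exp_minus field_simps)
  then show False using exp_ge_add_one_self[of C] by linarith
qed

theorem local_limit:
  assumes "\<exists>x y. swap_pair x y"
  shows "(\<lambda>n. sqrt (real n) * avg n (\<lambda>xs. of_bool (score (v @ xs) = 0))) \<longlonglongrightarrow> 1 / sqrt (2 * pi * svar)"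
proof -
  obtain C c where C: "C > 0" and c: "c > 0"
    and bound: "\<And>n v t. \<bar>t\<bar> \<le> pi \<Longrightarrow> cmod (score_char n v t) \<le> C * exp (- c * t\<^sup>2 * real n)"
    using score_char_bound[OF assms] by blast
  have s: "svar > 0" by (rule svar_pos[OF assms])
  define F where "F n t = indicator {- (pi * sqrt (real n))..pi * sqrt (real n)} t *\<^sub>R score_char n v (t / sqrt (real n))"
    for n :: nat and t :: real
  define P where "P n = avg n (\<lambda>xs. of_bool (score (v @ xs) = 0) :: real)" for n
  \<comment> \<open>The shift to \<open>Suc n\<close> avoids the division by \<open>sqrt 0\<close>.\<close>
  have "(\<lambda>n. \<integral>t. F (Suc n) t \<partial>lborel) \<longlonglongrightarrow> (\<integral>t. complex_of_real (exp (- (svar * t\<^sup>2 / 2))) \<partial>lborel)"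
  proof (rule integral_dominated_convergence)
    show "F (Suc n) \<in> borel_measurable lborel" for n
      using has_bochner_integral_score_char[of "sqrt (real (Suc n))" "Suc n" v]
      unfolding F_def by (intro borel_measurable_has_bochner_integral) auto
    show "integrable lborel (\<lambda>t. C * exp (- (2 * c * t\<^sup>2 / 2)))"
      using has_bochner_integral_gauss[of "2 * c"] c
      by (intro integrable_mult_right) (auto simp: has_bochner_integral_iff)
    show "AE t in lborel. (\<lambda>n. F (Suc n) t) \<longlonglongrightarrow> of_real (exp (- (svar * t\<^sup>2 / 2)))"
    proof (rule AE_I2)
      fix t :: real
      have "(\<lambda>n. \<bar>t\<bar> / sqrt (real n)) \<longlonglongrightarrow> 0" by real_asymp
      then have "\<forall>\<^sub>F n in sequentially. \<bar>t\<bar> / sqrt (real n) < pi"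
        using pi_gt_zero by (intro order_tendstoD) auto
      then have "\<forall>\<^sub>F n in sequentially. score_char n v (t / sqrt (real n)) = F n t"
        using eventually_gt_at_top[of 0]
      proof eventually_elim
        case (elim n)
        then have "\<bar>t\<bar> < pi * sqrt (real n)" by (simp add: field_simps)
        then show ?case by (auto simp: F_def indicator_def)
      qed
      with score_char_limit have "(\<lambda>n. F n t) \<longlonglongrightarrow> of_real (exp (- (svar * t\<^sup>2 / 2)))"
        by (rule Lim_transform_eventually)
      then show "(\<lambda>n. F (Suc n) t) \<longlonglongrightarrow> of_real (exp (- (svar * t\<^sup>2 / 2)))"
        by (rule LIMSEQ_Suc)
    qed
    show "AE t in lborel. cmod (F (Suc n) t) \<le> C * exp (- (2 * c * t\<^sup>2 / 2))" for n
    proof (rule AE_I2)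
      fix t :: real
      let ?r = "sqrt (real (Suc n))"
      show "cmod (F (Suc n) t) \<le> C * exp (- (2 * c * t\<^sup>2 / 2))"
      proof (cases "\<bar>t\<bar> \<le> pi * ?r")
        case True
        then have "\<bar>t / ?r\<bar> \<le> pi" by (simp add: abs_divide divide_le_eq)
        then have "cmod (score_char (Suc n) v (t / ?r)) \<le> C * exp (- c * (t / ?r)\<^sup>2 * real (Suc n))"
          by (rule bound)
        also have "- c * (t / ?r)\<^sup>2 * real (Suc n) = - (2 * c * t\<^sup>2 / 2)"
          by (simp add: power_divide del: of_nat_Suc)
        finally show ?thesis using C by (simp add: F_def indicator_def del: of_nat_Suc)
      next
        case False
        then have "t \<notin> {- (pi * ?r)..pi * ?r}" by auto
        then show ?thesis using C by (simp add: F_def del: of_nat_Suc)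
      qed
    qed
  qed auto
  moreover have "(\<integral>t. F (Suc n) t \<partial>lborel) = of_real (2 * pi * sqrt (real (Suc n)) * P (Suc n))" for n
    using has_bochner_integral_score_char[of "sqrt (real (Suc n))" "Suc n" v]
    unfolding F_def P_def by (auto simp: has_bochner_integral_iff)
  moreover have "(\<integral>t. complex_of_real (exp (- (svar * t\<^sup>2 / 2))) \<partial>lborel) = of_real (sqrt (2 * pi / svar))"
    using has_bochner_integral_gauss[OF s] by (simp add: has_bochner_integral_iff)
  ultimately have "(\<lambda>n. complex_of_real (2 * pi * sqrt (real (Suc n)) * P (Suc n))) \<longlonglongrightarrow> of_real (sqrt (2 * pi / svar))"
    by simp
  then have "(\<lambda>n. 2 * pi * sqrt (real (Suc n)) * P (Suc n)) \<longlonglongrightarrow> sqrt (2 * pi / svar)"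
    by (simp only: tendsto_of_real_iff)
  then have "(\<lambda>n. 2 * pi * sqrt (real n) * P n) \<longlonglongrightarrow> sqrt (2 * pi / svar)"
    using filterlim_sequentially_Suc[of "\<lambda>n. 2 * pi * sqrt (real n) * P n"] by simp
  then have "(\<lambda>n. 2 * pi * sqrt (real n) * P n / (2 * pi)) \<longlonglongrightarrow> sqrt (2 * pi / svar) / (2 * pi)"
    by (intro tendsto_divide tendsto_const) auto
  moreover have "sqrt (2 * pi / svar) / (2 * pi) = 1 / sqrt (2 * pi * svar)"
  proof -
    have "sqrt (2 * pi / svar) * sqrt (2 * pi * svar) = 2 * pi"
      using s real_sqrt_abs[of "2 * pi"] by (simp add: power2_eq_square flip: real_sqrt_mult)
    then show ?thesis using s by (simp add: field_simps)
  qed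
  ultimately show ?thesis by (simp add: P_def)
qed

section \<open>Stopping at the next occurrence\<close>


text \<open>A word shorter than \<open>L\<close> is its own final window here, which has sign zero as its length is not \<open>L\<close>.\<close>
definition end_sgn :: "bool list \<Rightarrow> int" where
  "end_sgn u = sgn_word (drop (length u - L) u)"

definition no_hit :: "bool list \<Rightarrow> bool list \<Rightarrow> bool" where
  "no_hit u xs \<longleftrightarrow> (\<forall>k. 1 \<le> k \<and> k \<le> length xs \<longrightarrow> end_sgn (u @ take k xs) = 0)"

definition first_hit :: "bool list \<Rightarrow> bool list \<Rightarrow> bool" where
  "first_hit u xs \<longleftrightarrow> xs \<noteq> [] \<and> no_hit u (butlast xs) \<and> end_sgn (u @ xs) \<noteq> 0"

lemma end_sgn_cases: "end_sgn u = 1 \<or> end_sgn u = - 1 \<or> end_sgn u = 0"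
  by (auto simp: end_sgn_def sgn_word_def)

lemma end_sgn_drop: "length w \<ge> L \<Longrightarrow> end_sgn (p @ w) = end_sgn w"
  by (simp add: end_sgn_def)

lemma end_sgn_eq_imp_suffix:
  "end_sgn u = 1 \<Longrightarrow> \<exists>p. u = p @ a" "end_sgn u = - 1 \<Longrightarrow> \<exists>p. u = p @ b"
proof -
  have u: "u = take (length u - L) u @ drop (length u - L) u" by simp
  show "end_sgn u = 1 \<Longrightarrow> \<exists>p. u = p @ a"
    using u unfolding end_sgn_def sgn_word_eq_iff by metis
  show "end_sgn u = - 1 \<Longrightarrow> \<exists>p. u = p @ b"
    using u unfolding end_sgn_def sgn_word_eq_iff by metis
qed

lemma score_snoc_end_sgn: "score (u @ [x]) = score u + end_sgn (u @ [x])"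
  by (simp only: score_snoc end_sgn_def length_append_singleton Suc_eq_plus1)

lemma no_hit_Nil [simp]: "no_hit u []"
  by (simp add: no_hit_def)

lemma no_hit_append: "no_hit u (xs @ ys) \<longleftrightarrow> no_hit u xs \<and> no_hit (u @ xs) ys"
proof
  assume *: "no_hit u (xs @ ys)"
  show "no_hit u xs \<and> no_hit (u @ xs) ys"
    unfolding no_hit_def
  proof (intro conjI allI impI)
    fix k assume "1 \<le> k \<and> k \<le> length xs"
    then show "end_sgn (u @ take k xs) = 0" using *[unfolded no_hit_def, rule_format, of k] by simp
  next
    fix k assume "1 \<le> k \<and> k \<le> length ys"
    then show "end_sgn ((u @ xs) @ take k ys) = 0"
      using *[unfolded no_hit_def, rule_format, of "length xs + k"] by simp
  qed
next
  assume *: "no_hit u xs \<and> no_hit (u @ xs) ys"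
  show "no_hit u (xs @ ys)"
    unfolding no_hit_def
  proof (intro allI impI)
    fix k assume k: "1 \<le> k \<and> k \<le> length (xs @ ys)"
    show "end_sgn (u @ take k (xs @ ys)) = 0"
    proof (cases "k \<le> length xs")
      case True
      then show ?thesis using * k by (simp add: no_hit_def)
    next
      case False
      then have "1 \<le> k - length xs \<and> k - length xs \<le> length ys" using k by auto
      then have "end_sgn ((u @ xs) @ take (k - length xs) ys) = 0"
        using * unfolding no_hit_def by blast
      then show ?thesis using False by simp
    qed
  qed
qed

lemma no_hit_single: "no_hit u [x] \<longleftrightarrow> end_sgn (u @ [x]) = 0"
proof -
  have "(\<forall>k. 1 \<le> k \<and> k \<le> length [x] \<longrightarrow> end_sgn (u @ take k [x]) = 0) \<longleftrightarrow> end_sgn (u @ take 1 [x]) = 0"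
    by (auto simp: le_Suc_eq)
  then show ?thesis by (simp add: no_hit_def)
qed

lemma no_hit_drop: "length w \<ge> L \<Longrightarrow> no_hit (p @ w) xs = no_hit w xs"
  using end_sgn_drop[of "w @ take k xs" p for k] by (simp add: no_hit_def)

lemma first_hit_drop: "length w \<ge> L \<Longrightarrow> first_hit (p @ w) xs = first_hit w xs"
  using end_sgn_drop[of "w @ xs" p] by (simp add: first_hit_def no_hit_drop)

lemma first_hit_snoc: "first_hit u (xs @ [x]) \<longleftrightarrow> no_hit u xs \<and> \<not> no_hit (u @ xs) [x]"
  by (simp add: first_hit_def no_hit_single)

lemma score_no_hit: "no_hit u xs \<Longrightarrow> score (u @ xs) = score u"
proof (induction xs rule: rev_induct)
  case (snoc x xs)
  then show ?case using score_snoc_end_sgn[of "u @ xs" x] by (simp add: no_hit_append no_hit_single)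
qed simp

lemma score_first_hit:
  assumes "first_hit u xs" shows "score (u @ xs) = score u + end_sgn (u @ xs)"
proof -
  have "xs = butlast xs @ [last xs]" using assms by (simp add: first_hit_def)
  then have "u @ xs = (u @ butlast xs) @ [last xs]" by simp
  then show ?thesis
    using assms score_snoc_end_sgn[of "u @ butlast xs" "last xs"] score_no_hit[of u "butlast xs"]
    by (simp add: first_hit_def)
qed

text \<open>Optional stopping at the first hit after \<open>u\<close>, truncated at time \<open>n\<close>: averaging over one more letter
splits the words without a hit into those that hit now and those that still do not.\<close>
lemma optional_stopping:
  fixes \<Phi> :: "bool list \<Rightarrow> real"
  assumes mart: "\<And>u. avg (Suc 0) (\<lambda>y. \<Phi> (u @ y)) = \<Phi> u"
  shows "\<Phi> u = (\<Sum>s\<le>n. avg s (\<lambda>xs. of_bool (first_hit u xs) * \<Phi> (u @ xs)))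
     + avg n (\<lambda>xs. of_bool (no_hit u xs) * \<Phi> (u @ xs))"
proof (induction n)
  case 0
  then show ?case by (simp add: first_hit_def)
next
  case (Suc n)
  have "avg n (\<lambda>xs. of_bool (no_hit u xs) * \<Phi> (u @ xs))
      = avg n (\<lambda>xs. avg (Suc 0) (\<lambda>y. of_bool (no_hit u xs) * \<Phi> ((u @ xs) @ y)))"
    by (simp only: avg_cmult mart)
  also have "\<dots> = avg n (\<lambda>xs. avg (Suc 0) (\<lambda>y. of_bool (first_hit u (xs @ y)) * \<Phi> (u @ xs @ y)
       + of_bool (no_hit u (xs @ y)) * \<Phi> (u @ xs @ y)))"
  proof (intro avg_cong)
    fix xs y :: "bool list" assume "length y = Suc 0"
    then obtain x where "y = [x]" by (auto simp: length_Suc_conv)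
    then show "of_bool (no_hit u xs) * \<Phi> ((u @ xs) @ y) = of_bool (first_hit u (xs @ y)) * \<Phi> (u @ xs @ y)
       + of_bool (no_hit u (xs @ y)) * \<Phi> (u @ xs @ y)"
      by (simp add: first_hit_snoc no_hit_append)
  qed
  also have "\<dots> = avg (Suc n) (\<lambda>xs. of_bool (first_hit u xs) * \<Phi> (u @ xs))
      + avg (Suc n) (\<lambda>xs. of_bool (no_hit u xs) * \<Phi> (u @ xs))"
    using avg_append[of n "Suc 0" "\<lambda>xs. of_bool (first_hit u xs) * \<Phi> (u @ xs)"]
      avg_append[of n "Suc 0" "\<lambda>xs. of_bool (no_hit u xs) * \<Phi> (u @ xs)"]
    by (simp add: avg_add)
  finally show ?case using Suc by simp
qed

definition hit_prob :: "bool list \<Rightarrow> int \<Rightarrow> nat \<Rightarrow> real" where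
  "hit_prob u e s = avg s (\<lambda>xs. of_bool (first_hit u xs \<and> end_sgn (u @ xs) = e))"

definition miss_prob :: "bool list \<Rightarrow> nat \<Rightarrow> real" where
  "miss_prob u n = avg n (\<lambda>xs. of_bool (no_hit u xs))"

lemma hit_prob_nonneg: "hit_prob u e s \<ge> 0"
  unfolding hit_prob_def using avg_mono[of s "\<lambda>_. 0"] by simp

lemma miss_prob_nonneg: "miss_prob u s \<ge> 0"
  unfolding miss_prob_def using avg_mono[of s "\<lambda>_. 0"] by simp

text \<open>Every block of \<open>L\<close> letters equals \<open>a\<close> with probability \<open>1 / 2 ^ L\<close>, and then there is a hit.\<close>
lemma miss_prob_bound: "miss_prob u (k * L) \<le> (1 - 1 / 2 ^ L) ^ k"
proof (induction k arbitrary: u)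
  case 0
  then show ?case by (simp add: miss_prob_def)
next
  case (Suc k)
  let ?r = "(1 - 1 / 2 ^ L :: real) ^ k"
  have "miss_prob u (Suc k * L) = avg L (\<lambda>y. avg (k * L) (\<lambda>z. of_bool (no_hit u (y @ z))))"
    by (simp add: miss_prob_def avg_append)
  also have "\<dots> \<le> avg L (\<lambda>y. of_bool (y \<noteq> a) * ?r)"
  proof (rule avg_mono)
    fix y :: "bool list" assume "length y = L"
    have "avg (k * L) (\<lambda>z. of_bool (no_hit u (y @ z)) :: real)
       \<le> avg (k * L) (\<lambda>z. of_bool (y \<noteq> a) * of_bool (no_hit (u @ y) z))"
    proof (rule avg_mono)
      fix z
      have "\<not> no_hit u a"
      proof
        assume "no_hit u a"
        then have "end_sgn (u @ a) = 0" using L_pos len_a by (auto simp: no_hit_def dest: spec[of _ L])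
        then show False using end_sgn_drop[of a u] len_a by (simp add: end_sgn_def)
      qed
      then show "of_bool (no_hit u (y @ z)) \<le> of_bool (y \<noteq> a) * (of_bool (no_hit (u @ y) z) :: real)"
        by (auto simp: no_hit_append)
    qed
    also have "\<dots> = of_bool (y \<noteq> a) * miss_prob (u @ y) (k * L)"
      by (simp only: avg_cmult miss_prob_def)
    also have "\<dots> \<le> of_bool (y \<noteq> a) * ?r" using Suc by (intro mult_left_mono) auto
    finally show "avg (k * L) (\<lambda>z. of_bool (no_hit u (y @ z))) \<le> of_bool (y \<noteq> a) * ?r" .
  qed
  also have "\<dots> = (1 - 1 / 2 ^ L) * ?r"
  proof -
    have "avg L (\<lambda>y. of_bool (y = a)) = (1 / 2 ^ L :: real)"
      using avg_point[OF len_a, of "\<lambda>_. 1"] by simp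
    moreover have "avg L (\<lambda>y. of_bool (y \<noteq> a)) = avg L (\<lambda>y. 1 - of_bool (y = a) :: real)"
      by (rule avg_cong) simp
    ultimately show ?thesis by (simp only: avg_cmult_right avg_diff avg_const)
  qed
  finally show ?case by simp
qed

lemma miss_prob_limit: "(\<lambda>k. miss_prob u (k * L)) \<longlonglongrightarrow> 0"
proof (rule tendsto_sandwich[where f = "\<lambda>_. 0" and h = "\<lambda>k. (1 - 1 / 2 ^ L) ^ k"])
  have "0 < (1 / 2 ^ L :: real)" "(1 / 2 ^ L :: real) \<le> 1" by simp_all
  then have "norm (1 - 1 / 2 ^ L :: real) < 1" unfolding real_norm_def by linarith
  then show "(\<lambda>k. (1 - 1 / 2 ^ L :: real) ^ k) \<longlonglongrightarrow> 0"
    by (rule LIMSEQ_power_zero)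
qed (auto intro!: always_eventually miss_prob_nonneg miss_prob_bound)

lemma hit_prob_total:
  "(\<Sum>s\<le>n. hit_prob u 1 s) + (\<Sum>s\<le>n. hit_prob u (- 1) s) + miss_prob u n = 1"
proof -
  have "avg s (\<lambda>xs. of_bool (first_hit u xs) * 1) = hit_prob u 1 s + hit_prob u (- 1) s" for s
    unfolding hit_prob_def avg_add[symmetric]
    by (rule avg_cong) (use end_sgn_cases in \<open>auto simp: first_hit_def\<close>)
  then show ?thesis
    using optional_stopping[of "\<lambda>_. 1" u n] by (simp add: miss_prob_def sum.distrib)
qed

lemma hit_prob_summable:
  assumes "e = 1 \<or> e = - 1" shows "summable (hit_prob u e)"
proof (rule summableI_nonneg_bounded[where x = 1])
  fix n
  have "(\<Sum>s<n. hit_prob u e s) \<le> (\<Sum>s\<le>n. hit_prob u e s)"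
    by (intro sum_mono2) (auto simp: hit_prob_nonneg)
  also have "\<dots> \<le> 1"
    using hit_prob_total[of u n] assms miss_prob_nonneg[of u n]
      sum_nonneg[of "{..n}" "hit_prob u 1"] sum_nonneg[of "{..n}" "hit_prob u (- 1)"] hit_prob_nonneg
    by auto
  finally show "(\<Sum>s<n. hit_prob u e s) \<le> 1" .
qed (rule hit_prob_nonneg)

lemma hit_prob_limit:
  assumes "e = 1 \<or> e = - 1" shows "(\<lambda>k. \<Sum>s\<le>k * L. hit_prob u e s) \<longlonglongrightarrow> suminf (hit_prob u e)"
proof -
  have "strict_mono (\<lambda>k. k * L)" using L_pos by (auto simp: strict_mono_def)
  moreover have "(\<lambda>n. \<Sum>s\<le>n. hit_prob u e s) \<longlonglongrightarrow> suminf (hit_prob u e)"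
    using hit_prob_summable[OF assms] summable_LIMSEQ' by blast
  ultimately show ?thesis unfolding o_def[symmetric]
    using LIMSEQ_subseq_LIMSEQ[of "\<lambda>n. \<Sum>s\<le>n. hit_prob u e s" _ "\<lambda>k. k * L"] by (simp add: o_def)
qed

lemma hit_prob_suminf: "suminf (hit_prob u 1) + suminf (hit_prob u (- 1)) = 1"
proof -
  have "(\<lambda>k. (\<Sum>s\<le>k * L. hit_prob u 1 s) + (\<Sum>s\<le>k * L. hit_prob u (- 1) s) + miss_prob u (k * L))
     \<longlonglongrightarrow> suminf (hit_prob u 1) + suminf (hit_prob u (- 1)) + 0"
    by (intro tendsto_add hit_prob_limit miss_prob_limit) auto
  then show ?thesis by (simp add: hit_prob_total LIMSEQ_const_iff)
qed

lemma drift_suffix: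
  assumes "length w \<ge> L" shows "drift (p @ w) = drift w"
proof -
  have *: "avg L (\<lambda>z. of_int (score (u @ z))) - of_int (score u)
     = avg L (\<lambda>z. real_of_int (score (drop (length u - (L - 1)) u @ z)))" for u
    by (subst score_append_drop) (simp add: avg_add)
  show ?thesis unfolding drift_def * using assms by simp
qed

lemma drift_abs: "\<bar>drift u\<bar> \<le> real L"
proof -
  have "drift u = avg L (\<lambda>z. of_int (score (u @ z) - score u))"
    by (simp add: drift_def avg_diff)
  also have "norm \<dots> \<le> real L"
  proof (rule norm_avg_le_const)
    fix z :: "bool list" assume "length z = L"
    then have "\<bar>score (u @ z) - score u\<bar> \<le> int L" using score_append_abs_right[of u z] by simp
    then show "norm (real_of_int (score (u @ z) - score u)) \<le> real L"
      unfolding real_norm_def by linarith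
  qed
  finally show ?thesis by simp
qed

text \<open>The martingale \<open>\<Phi>\<close> is score plus drift, the expected final score. It starts at
\<open>1 + drift a\<close>; at the first hit it is \<open>2 + drift a\<close> if \<open>a\<close> occurs
again and \<open>0 + drift b\<close> if \<open>b\<close> occurs. Up to that time it is bounded, so the truncation is harmless.\<close>
lemma drift_equation:
  defines "p \<equiv> suminf (hit_prob a 1)"
  shows "(1 - p) * (drift a - drift b + 1) = p" "p \<noteq> 1"
proof -
  define q where "q = suminf (hit_prob a (- 1))"
  have pq: "p + q = 1" unfolding p_def q_def by (rule hit_prob_suminf)
  define \<Phi> where "\<Phi> u = of_int (score u) + drift u" for u
  have \<Phi>: "\<Phi> u = avg L (\<lambda>z. of_int (score (u @ z)))" for u
    by (simp add: \<Phi>_def drift_def)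
  have mart: "avg (Suc 0) (\<lambda>y. \<Phi> (u @ y)) = \<Phi> u" for u
    unfolding \<Phi> append_assoc
    using avg_append[of "Suc 0" L "\<lambda>w. real_of_int (score (u @ w))"] avg_score_snoc[of L u] by simp
  have stop: "\<Phi> a = (2 + drift a) * (\<Sum>s\<le>n. hit_prob a 1 s) + drift b * (\<Sum>s\<le>n. hit_prob a (- 1) s)
      + avg n (\<lambda>xs. of_bool (no_hit a xs) * \<Phi> (a @ xs))" for n
  proof -
    have "avg s (\<lambda>xs. of_bool (first_hit a xs) * \<Phi> (a @ xs))
        = (2 + drift a) * hit_prob a 1 s + drift b * hit_prob a (- 1) s" for s
      unfolding hit_prob_def avg_add[symmetric] avg_cmult[symmetric]
    proof (rule avg_cong)
      fix xs
      consider "\<not> first_hit a xs" | "first_hit a xs" "end_sgn (a @ xs) = 1" | "first_hit a xs" "end_sgn (a @ xs) = - 1"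
        using end_sgn_cases[of "a @ xs"] by (auto simp: first_hit_def)
      then show "of_bool (first_hit a xs) * \<Phi> (a @ xs) = (2 + drift a) * of_bool (first_hit a xs \<and> end_sgn (a @ xs) = 1)
          + drift b * of_bool (first_hit a xs \<and> end_sgn (a @ xs) = - 1)"
      proof cases
        case 2
        then obtain r where "a @ xs = r @ a" using end_sgn_eq_imp_suffix(1) by blast
        then have "drift (a @ xs) = drift a" using drift_suffix[of a r] len_a by simp
        then show ?thesis using 2 score_first_hit[OF 2(1)] len_a by (simp add: \<Phi>_def score_full)
      next
        case 3
        then obtain r where "a @ xs = r @ b" using end_sgn_eq_imp_suffix(2) by blast
        then have "drift (a @ xs) = drift b" using drift_suffix[of b r] len_b by simp
        then show ?thesis using 3 score_first_hit[OF 3(1)] len_a by (simp add: \<Phi>_def score_full)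
      qed simp
    qed
    then show ?thesis
      using optional_stopping[OF mart, of a n] by (simp add: sum.distrib sum_distrib_left)
  qed
  have "(\<lambda>k. avg (k * L) (\<lambda>xs. of_bool (no_hit a xs) * \<Phi> (a @ xs))) \<longlonglongrightarrow> 0"
  proof (rule Lim_null_comparison)
    show "(\<lambda>k. miss_prob a (k * L) * (1 + real L)) \<longlonglongrightarrow> 0"
      using tendsto_mult_left_zero[OF miss_prob_limit] by blast
    show "\<forall>\<^sub>F k in sequentially. norm (avg (k * L) (\<lambda>xs. of_bool (no_hit a xs) * \<Phi> (a @ xs))) \<le> miss_prob a (k * L) * (1 + real L)"
    proof (intro always_eventually allI)
      fix k
      have "norm (avg (k * L) (\<lambda>xs. of_bool (no_hit a xs) * \<Phi> (a @ xs)))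
        \<le> avg (k * L) (\<lambda>xs. norm (of_bool (no_hit a xs) * \<Phi> (a @ xs)))"
        by (rule norm_avg_le)
      also have "\<dots> \<le> avg (k * L) (\<lambda>xs. of_bool (no_hit a xs) * (1 + real L))"
      proof (rule avg_mono)
        fix xs
        show "norm (of_bool (no_hit a xs) * \<Phi> (a @ xs)) \<le> of_bool (no_hit a xs) * (1 + real L)"
          using drift_abs[of "a @ xs"] score_no_hit[of a xs] len_a
          by (cases "no_hit a xs") (auto simp: \<Phi>_def score_full)
      qed
      finally show "norm (avg (k * L) (\<lambda>xs. of_bool (no_hit a xs) * \<Phi> (a @ xs))) \<le> miss_prob a (k * L) * (1 + real L)"
        by (simp add: avg_cmult_right miss_prob_def)
    qed
  qed
  then have "(\<lambda>k. (2 + drift a) * (\<Sum>s\<le>k * L. hit_prob a 1 s) + drift b * (\<Sum>s\<le>k * L. hit_prob a (- 1) s)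
      + avg (k * L) (\<lambda>xs. of_bool (no_hit a xs) * \<Phi> (a @ xs))) \<longlonglongrightarrow> (2 + drift a) * p + drift b * q + 0"
    unfolding p_def q_def by (intro tendsto_intros hit_prob_limit) auto
  then have "\<Phi> a = (2 + drift a) * p + drift b * q"
    by (simp add: stop[symmetric] LIMSEQ_const_iff)
  moreover have "\<Phi> a = 1 + drift a" using len_a by (simp add: \<Phi>_def score_full)
  moreover have q: "q = 1 - p" using pq by simp
  ultimately show *: "(1 - p) * (drift a - drift b + 1) = p"
    by (simp add: algebra_simps)
  then show "p \<noteq> 1" by auto
qed

lemma svar_eq:
  defines "p \<equiv> suminf (hit_prob a 1)"
  shows "svar = 2 * p / ((1 - p) * 2 ^ L)"
proof -
  have "drift a - drift b + 1 = p / (1 - p)"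
    using drift_equation unfolding p_def by (simp add: field_simps)
  moreover have "svar = 2 * (drift a - drift b + 1) / 2 ^ L"
    by (simp add: svar_def algebra_simps)
  ultimately show ?thesis by simp
qed

end

section \<open>Transfer to the Bernoulli process\<close>

context symmetric_bernoulli_process
begin

definition prefix_word :: "nat \<Rightarrow> 'a \<Rightarrow> bool list" where
  "prefix_word n \<omega> = map (\<lambda>i. X i \<omega>) [1..<n + 1]"

lemma length_prefix_word [simp]: "length (prefix_word n \<omega>) = n"
  by (simp add: prefix_word_def)

lemma prefix_word_0 [simp]: "prefix_word 0 \<omega> = []"
  by (simp add: prefix_word_def)

lemma prefix_word_Suc: "prefix_word (Suc n) \<omega> = prefix_word n \<omega> @ [X (Suc n) \<omega>]"
  by (simp add: prefix_word_def)

lemma take_prefix_word: "m \<le> n \<Longrightarrow> take m (prefix_word n \<omega>) = prefix_word m \<omega>"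
proof (induction n)
  case (Suc n)
  then show ?case by (cases "m = Suc n") (auto simp: prefix_word_Suc)
qed simp

lemma drop_prefix_word: "drop (n - m) (prefix_word n \<omega>) = map (\<lambda>i. X i \<omega>) [n + 1 - m..<n + 1]" if "m \<le> n"
  using that by (simp add: prefix_word_def drop_map Suc_diff_le del: upt_Suc)

lemma letter_event [measurable]: "i \<ge> 1 \<Longrightarrow> {\<omega>\<in>space M. X i \<omega> = c} \<in> events"
proof -
  assume "i \<ge> 1"
  then have "X i -` {c} \<inter> space M \<in> events"
    using indep by (intro measurable_sets[of _ M "count_space UNIV"]) (auto simp: indep_vars_def2)
  then show ?thesis by (simp add: vimage_def Int_def conj_commute)
qed

lemma prefix_word_eq_event:
  assumes "length xs = n"
  shows "{\<omega>\<in>space M. prefix_word n \<omega> = xs} \<in> events"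
    and "\<P>(\<omega> in M. prefix_word n \<omega> = xs) = 1 / 2 ^ n"
proof -
  define A where "A i = {\<omega>\<in>space M. X i \<omega> = xs ! (i - 1)}" for i
  have eq: "prefix_word n \<omega> = xs \<longleftrightarrow> (\<forall>i\<in>{1..n}. X i \<omega> = xs ! (i - 1))" for \<omega>
  proof -
    have "prefix_word n \<omega> = xs \<longleftrightarrow> (\<forall>i<n. X (Suc i) \<omega> = xs ! i)"
      using assms by (auto simp: list_eq_iff_nth_eq prefix_word_def simp del: upt_Suc)
    also have "\<dots> \<longleftrightarrow> (\<forall>i\<in>{1..n}. X i \<omega> = xs ! (i - 1))"
    proof (rule iffI; intro ballI allI impI)
      fix i assume "\<forall>i<n. X (Suc i) \<omega> = xs ! i" "i \<in> {1..n}"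
      then show "X i \<omega> = xs ! (i - 1)" by (cases i) auto
    next
      fix i assume "\<forall>i\<in>{1..n}. X i \<omega> = xs ! (i - 1)" "i < n"
      then show "X (Suc i) \<omega> = xs ! i" by (auto dest: bspec[of _ _ "Suc i"])
    qed
    finally show ?thesis .
  qed
  have "{\<omega>\<in>space M. prefix_word n \<omega> = xs} \<in> events \<and> \<P>(\<omega> in M. prefix_word n \<omega> = xs) = 1 / 2 ^ n"
  proof (cases "n = 0")
    case True
    then show ?thesis using assms by (simp add: prob_space)
  next
    case False
    have set: "{\<omega>\<in>space M. prefix_word n \<omega> = xs} = (\<Inter>i\<in>{1..n}. A i)"
    proof -
      have "1 \<in> {1..n}" using False by simp
      then show ?thesis unfolding eq A_def by blast
    qed
    have A: "A i \<in> events" if "i \<in> {1..n}" for i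
      unfolding A_def using that by (intro letter_event) auto
    have "prob (\<Inter>i\<in>{1..n}. A i) = (\<Prod>i\<in>{1..n}. prob (A i))"
    proof (rule indep_setsD)
      show "indep_sets (\<lambda>i. {X i -` B \<inter> space M |B. B \<in> sets (count_space UNIV)}) {1..}"
        using indep by (simp add: indep_vars_def2)
      show "\<forall>i\<in>{1..n}. A i \<in> {X i -` B \<inter> space M |B. B \<in> sets (count_space UNIV)}"
      proof
        fix i
        have "A i = X i -` {xs ! (i - 1)} \<inter> space M" by (auto simp: A_def)
        then show "A i \<in> {X i -` B \<inter> space M |B. B \<in> sets (count_space UNIV)}" by auto
      qed
    qed (use False in auto)
    also have "\<dots> = (\<Prod>i\<in>{1..n}. 1 / 2)"
    proof (rule prod.cong)
      fix i assume "i \<in> {1..n}"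
      then show "prob (A i) = 1 / 2"
        using prob_one[of i] prob_zero[of i] unfolding A_def by (cases "xs ! (i - 1)") auto
    qed simp
    finally show ?thesis unfolding set using A False by (auto simp: power_one_over)
  qed
  then show "{\<omega>\<in>space M. prefix_word n \<omega> = xs} \<in> events"
    and "\<P>(\<omega> in M. prefix_word n \<omega> = xs) = 1 / 2 ^ n" by auto
qed

lemma prefix_word_event: "{\<omega>\<in>space M. Q (prefix_word n \<omega>)} \<in> events"
  and prob_prefix_word: "\<P>(\<omega> in M. Q (prefix_word n \<omega>)) = avg n (\<lambda>xs. of_bool (Q xs))"
proof -
  let ?W = "{xs\<in>words n. Q xs}"
  have set: "{\<omega>\<in>space M. Q (prefix_word n \<omega>)} = (\<Union>xs\<in>?W. {\<omega>\<in>space M. prefix_word n \<omega> = xs})"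
    by (auto simp: words_def)
  have W: "{\<omega>\<in>space M. prefix_word n \<omega> = xs} \<in> events" if "xs \<in> ?W" for xs
    using that by (intro prefix_word_eq_event) (auto simp: words_def)
  show "{\<omega>\<in>space M. Q (prefix_word n \<omega>)} \<in> events"
    unfolding set using W by (intro sets.finite_UN) auto
  have "\<P>(\<omega> in M. Q (prefix_word n \<omega>)) = (\<Sum>xs\<in>?W. \<P>(\<omega> in M. prefix_word n \<omega> = xs))"
    unfolding set using W by (intro finite_measure_finite_Union) (auto simp: disjoint_family_on_def)
  also have "\<dots> = (\<Sum>xs\<in>?W. 1 / 2 ^ n)"
    by (intro sum.cong prefix_word_eq_event) (auto simp: words_def)
  also have "\<dots> = avg n (\<lambda>xs. of_bool (Q xs))"
    by (simp add: avg_def sum.inter_filter[symmetric] of_bool_def sum.If_cases Int_def)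
  finally show "\<P>(\<omega> in M. Q (prefix_word n \<omega>)) = avg n (\<lambda>xs. of_bool (Q xs))" .
qed

end

locale process_word_pair = symmetric_bernoulli_process M X + word_pair L a b
  for M :: "'a measure" and X L a b
begin

lemma window_eq_drop: "t \<ge> L \<Longrightarrow> window X L t \<omega> = drop (t - L) (prefix_word t \<omega>)"
  by (simp add: window_def drop_prefix_word del: upt_Suc)

lemma sgn_window: "sgn_word (window X L t \<omega>) = end_sgn (prefix_word t \<omega>)"
proof (cases "t \<ge> L")
  case True
  then show ?thesis by (simp add: window_eq_drop end_sgn_def)
next
  case False
  then show ?thesis using L_pos by (simp add: window_def end_sgn_def sgn_word_length)
qed

lemma window_iff:
  "window X L t \<omega> = a \<longleftrightarrow> end_sgn (prefix_word t \<omega>) = 1"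
  "window X L t \<omega> = b \<longleftrightarrow> end_sgn (prefix_word t \<omega>) = - 1"
  "window X L t \<omega> \<in> {a, b} \<longleftrightarrow> end_sgn (prefix_word t \<omega>) \<noteq> 0"
  using sgn_word_eq_iff[of "window X L t \<omega>"] by (auto simp: sgn_window)

lemma occurrences_diff:
  "int (occurrences X n a \<omega>) - int (occurrences X n b \<omega>) = score (prefix_word n \<omega>)"
proof (induction n)
  case 0
  then show ?case using L_pos len_a len_b by (simp add: occurrences_def)
next
  case (Suc n)
  have step: "occurrences X (Suc n) y \<omega> = occurrences X n y \<omega> + of_bool (window X L (Suc n) \<omega> = y)"
    if "length y = L" for y
  proof (cases "L \<le> Suc n")
    case True
    then show ?thesis using that by (simp add: occurrences_def)
  next
    case False
    then have "[] \<noteq> y" using that L_pos by auto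
    then show ?thesis using that False by (simp add: occurrences_def window_def)
  qed
  have "sgn_word (window X L (Suc n) \<omega>) = end_sgn (prefix_word n \<omega> @ [X (Suc n) \<omega>])"
    by (simp add: sgn_window prefix_word_Suc)
  then show ?case
    using Suc step[OF len_a] step[OF len_b] score_snoc_end_sgn[of "prefix_word n \<omega>" "X (Suc n) \<omega>"]
    by (simp add: sgn_word_def prefix_word_Suc)
qed

lemma no_hit_prefix:
  "no_hit (prefix_word t \<omega>) (drop t (prefix_word (t + s) \<omega>)) \<longleftrightarrow> (\<forall>k\<in>{t<..t + s}. end_sgn (prefix_word k \<omega>) = 0)"
proof -
  have *: "prefix_word t \<omega> @ take j (drop t (prefix_word (t + s) \<omega>)) = prefix_word (t + j) \<omega>" if "j \<le> s" for j
  proof -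
    have "prefix_word (t + j) \<omega> = take (t + j) (prefix_word (t + s) \<omega>)"
      using that by (simp add: take_prefix_word)
    also have "\<dots> = take t (prefix_word (t + s) \<omega>) @ take j (drop t (prefix_word (t + s) \<omega>))"
      by (rule take_add)
    finally show ?thesis by (simp add: take_prefix_word)
  qed
  have "no_hit (prefix_word t \<omega>) (drop t (prefix_word (t + s) \<omega>)) \<longleftrightarrow>
      (\<forall>j. 1 \<le> j \<and> j \<le> s \<longrightarrow> end_sgn (prefix_word (t + j) \<omega>) = 0)"
    unfolding no_hit_def using * by simp
  also have "\<dots> \<longleftrightarrow> (\<forall>k\<in>{t<..t + s}. end_sgn (prefix_word k \<omega>) = 0)"
  proof safe
    fix k assume "\<forall>j. 1 \<le> j \<and> j \<le> s \<longrightarrow> end_sgn (prefix_word (t + j) \<omega>) = 0" "k \<in> {t<..t + s}"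
    then show "end_sgn (prefix_word k \<omega>) = 0"
      by (auto dest: spec[of _ "k - t"])
  qed auto
  finally show ?thesis .
qed

lemma first_hit_prefix:
  "first_hit (prefix_word t \<omega>) (drop t (prefix_word (t + s) \<omega>)) \<longleftrightarrow>
     s > 0 \<and> (\<forall>k\<in>{t<..<t + s}. end_sgn (prefix_word k \<omega>) = 0) \<and> end_sgn (prefix_word (t + s) \<omega>) \<noteq> 0"
proof (cases s)
  case (Suc s')
  have "prefix_word t \<omega> @ drop t (prefix_word (t + s) \<omega>) = prefix_word (t + s) \<omega>"
    by (metis append_take_drop_id le_add1 take_prefix_word)
  moreover have "butlast (drop t (prefix_word (t + s) \<omega>)) = drop t (prefix_word (t + s') \<omega>)"
    by (simp add: Suc prefix_word_Suc)
  moreover have "{t<..<t + s} = {t<..t + s'}" using Suc by auto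
  ultimately show ?thesis
    using Suc by (simp only: first_hit_def no_hit_prefix) auto
qed (simp add: first_hit_def)

text \<open>The first hit after time \<open>t\<close> happens at time \<open>t + s\<close>.\<close>
definition next_hit :: "nat \<Rightarrow> nat \<Rightarrow> 'a \<Rightarrow> bool" where
  "next_hit t s \<omega> \<longleftrightarrow> first_hit (prefix_word t \<omega>) (drop t (prefix_word (t + s) \<omega>))"

lemma next_hit_unique: 
  assumes "next_hit t s \<omega>" "next_hit t s' \<omega>" shows "s = s'"
proof -
  have "\<not> r < r'" if "next_hit t r \<omega>" "next_hit t r' \<omega>" for r r'
  proof
    assume "r < r'"
    then have "t + r \<in> {t<..<t + r'}" using that(1) by (simp add: next_hit_def first_hit_prefix)
    then show False using that unfolding next_hit_def first_hit_prefix by blast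
  qed
  then show ?thesis using assms by (metis linorder_neqE_nat)
qed

lemma next_hit_Least:
  assumes "next_hit t s \<omega>"
  shows "(LEAST k. k > t \<and> window X L k \<omega> \<in> {a, b}) = t + s"
  unfolding window_iff
proof (rule Least_equality)
  show "t < t + s \<and> end_sgn (prefix_word (t + s) \<omega>) \<noteq> 0"
    using assms unfolding next_hit_def first_hit_prefix by auto
  show "t + s \<le> k" if "t < k \<and> end_sgn (prefix_word k \<omega>) \<noteq> 0" for k
  proof (rule ccontr)
    assume "\<not> t + s \<le> k"
    then have "k \<in> {t<..<t + s}" using that by simp
    then show False using assms that unfolding next_hit_def first_hit_prefix by blast
  qed
qed

lemma next_hit_exists:
  assumes "end_sgn (prefix_word k \<omega>) \<noteq> 0" "k > t"
  shows "\<exists>s. next_hit t s \<omega>"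
proof -
  define m where "m = (LEAST k. t < k \<and> end_sgn (prefix_word k \<omega>) \<noteq> 0)"
  have m: "t < m \<and> end_sgn (prefix_word m \<omega>) \<noteq> 0"
    unfolding m_def by (rule LeastI[of _ k]) (use assms in auto)
  have "end_sgn (prefix_word j \<omega>) = 0" if "t < j" "j < m" for j
    using not_less_Least[of j "\<lambda>k. t < k \<and> end_sgn (prefix_word k \<omega>) \<noteq> 0"] that unfolding m_def by auto
  then have "next_hit t (m - t) \<omega>"
    unfolding next_hit_def first_hit_prefix using m by auto
  then show ?thesis by blast
qed

lemma next_hit_split:
  "next_hit t s \<omega> \<longleftrightarrow> first_hit (take t (prefix_word (t + s) \<omega>)) (drop t (prefix_word (t + s) \<omega>))"
  by (simp add: next_hit_def take_prefix_word)

lemma no_hit_after_null: "{\<omega>\<in>space M. \<forall>s. \<not> next_hit t s \<omega>} \<in> null_sets M"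
proof -
  let ?N = "{\<omega>\<in>space M. \<forall>s. \<not> next_hit t s \<omega>}"
  have ev: "{\<omega>\<in>space M. next_hit t s \<omega>} \<in> events" for s
    unfolding next_hit_split by (rule prefix_word_event)
  have N: "?N \<in> events"
    using ev by measurable
  have "prob ?N \<le> avg t (\<lambda>u. miss_prob u (k * L))" for k
  proof -
    have "prob ?N \<le> \<P>(\<omega> in M. no_hit (take t (prefix_word (t + k * L) \<omega>)) (drop t (prefix_word (t + k * L) \<omega>)))"
    proof (rule finite_measure_mono)
      show "?N \<subseteq> {\<omega>\<in>space M. no_hit (take t (prefix_word (t + k * L) \<omega>)) (drop t (prefix_word (t + k * L) \<omega>))}"
        by (auto simp: take_prefix_word no_hit_prefix) (meson next_hit_exists)
    qed (rule prefix_word_event)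
    also have "\<dots> = avg t (\<lambda>u. miss_prob u (k * L))"
      unfolding prob_prefix_word[of "\<lambda>w. no_hit (take t w) (drop t w)"] avg_append miss_prob_def
      by (intro avg_cong) simp
    finally show ?thesis .
  qed
  moreover have "avg t (\<lambda>u. miss_prob u (k * L)) \<le> (1 - 1 / 2 ^ L) ^ k" for k
    using avg_mono[of t "\<lambda>u. miss_prob u (k * L)" "\<lambda>_. (1 - 1 / 2 ^ L) ^ k"] miss_prob_bound by simp
  ultimately have le: "prob ?N \<le> (1 - 1 / 2 ^ L) ^ k" for k
    by (meson order_trans)
  have "0 < (1 / 2 ^ L :: real)" "(1 / 2 ^ L :: real) \<le> 1" by simp_all
  then have "norm (1 - 1 / 2 ^ L :: real) < 1" unfolding real_norm_def by linarith
  then have "(\<lambda>k. (1 - 1 / 2 ^ L :: real) ^ k) \<longlonglongrightarrow> 0"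
    by (rule LIMSEQ_power_zero)
  then have "prob ?N \<le> 0" using le by (intro LIMSEQ_le_const) auto
  then have "prob ?N = 0" using measure_nonneg[of M ?N] by linarith
  then show ?thesis using N by (simp add: null_sets_def emeasure_eq_measure)
qed

lemma hit_sign_1:
  "hit_sign X L a b 1 \<omega> = 1 \<longleftrightarrow> (\<exists>t. next_hit 0 t \<omega> \<and> end_sgn (prefix_word t \<omega>) = 1)"
proof (cases "\<exists>t. next_hit 0 t \<omega>")
  case True
  then obtain t where t: "next_hit 0 t \<omega>" by blast
  then have T: "hit_time X L a b 1 \<omega> = t" using next_hit_Least[OF t] by simp
  have "hit_sign X L a b 1 \<omega> = 1 \<longleftrightarrow> end_sgn (prefix_word t \<omega>) = 1"
    unfolding hit_sign_def T window_iff by simp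
  then show ?thesis using t next_hit_unique[OF t] by blast
next
  case False
  then have no: "end_sgn (prefix_word k \<omega>) = 0" for k
    using next_hit_exists[of k \<omega> 0] L_pos by (cases "k = 0") (auto simp: end_sgn_def sgn_word_length)
  show ?thesis using False unfolding hit_sign_def window_iff no by simp
qed

lemma hit_sign_2:
  assumes "next_hit 0 t \<omega>" "next_hit t s \<omega>"
  shows "hit_sign X L a b 2 \<omega> = 1 \<longleftrightarrow> end_sgn (prefix_word (t + s) \<omega>) = 1"
proof -
  have "hit_time X L a b 1 \<omega> = t" using next_hit_Least[OF assms(1)] by simp
  then have "hit_time X L a b 2 \<omega> = t + s"
    using next_hit_Least[OF assms(2)] by (simp add: numeral_2_eq_2)
  then show ?thesis unfolding hit_sign_def window_iff by simp
qed

definition stay_event :: "nat \<Rightarrow> nat \<Rightarrow> 'a set" where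
  "stay_event t s = {\<omega>\<in>space M. next_hit 0 t \<omega> \<and> end_sgn (prefix_word t \<omega>) = 1 \<and> next_hit t s \<omega> \<and> end_sgn (prefix_word (t + s) \<omega>) = 1}"

lemma prob_first_hit:
  "{\<omega>\<in>space M. next_hit 0 t \<omega> \<and> end_sgn (prefix_word t \<omega>) = 1} \<in> events"
  "\<P>(\<omega> in M. next_hit 0 t \<omega> \<and> end_sgn (prefix_word t \<omega>) = 1) = hit_prob [] 1 t"
proof -
  have eq: "next_hit 0 t \<omega> \<longleftrightarrow> first_hit [] (prefix_word t \<omega>)" for \<omega>
    by (simp add: next_hit_def)
  show "{\<omega>\<in>space M. next_hit 0 t \<omega> \<and> end_sgn (prefix_word t \<omega>) = 1} \<in> events"
    unfolding eq by (rule prefix_word_event)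
  show "\<P>(\<omega> in M. next_hit 0 t \<omega> \<and> end_sgn (prefix_word t \<omega>) = 1) = hit_prob [] 1 t"
    unfolding eq by (subst prob_prefix_word) (simp add: hit_prob_def)
qed

text \<open>The strong Markov property in the discrete setting: if the word up to time \<open>t\<close> ends with \<open>a\<close>, whether
the following letters produce their first hit after \<open>s\<close> steps depends only on this final \<open>a\<close>.\<close>
lemma prob_stay_event:
  "stay_event t s \<in> events"
  "prob (stay_event t s) = hit_prob [] 1 t * hit_prob a 1 s"
proof -
  define Q where "Q w \<longleftrightarrow> first_hit [] (take t w) \<and> end_sgn (take t w) = 1 \<and> first_hit (take t w) (drop t w) \<and> end_sgn w = 1"
    for w
  have eq: "stay_event t s = {\<omega>\<in>space M. Q (prefix_word (t + s) \<omega>)}"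
    unfolding stay_event_def Q_def next_hit_split[of t] by (simp add: next_hit_def take_prefix_word)
  show "stay_event t s \<in> events" unfolding eq by (rule prefix_word_event)
  have "prob (stay_event t s) = avg t (\<lambda>x. avg s (\<lambda>y. of_bool (Q (x @ y))))"
    unfolding eq prob_prefix_word avg_append ..
  also have "\<dots> = avg t (\<lambda>x. of_bool (first_hit [] x \<and> end_sgn ([] @ x) = 1) * hit_prob a 1 s)"
  proof (rule avg_cong)
    fix x :: "bool list" assume x: "length x = t"
    show "avg s (\<lambda>y. of_bool (Q (x @ y))) = of_bool (first_hit [] x \<and> end_sgn ([] @ x) = 1) * hit_prob a 1 s"
    proof (cases "first_hit [] x \<and> end_sgn x = 1")
      case True
      then obtain r where r: "x = r @ a" using end_sgn_eq_imp_suffix(1) by blast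
      have "Q (x @ y) \<longleftrightarrow> first_hit a y \<and> end_sgn (a @ y) = 1" for y
        using True x first_hit_drop[of a r y] end_sgn_drop[of "a @ y" r] len_a by (simp add: Q_def r)
      then show ?thesis using True by (simp add: hit_prob_def)
    next
      case False
      then have "\<not> Q (x @ y)" for y using x by (auto simp: Q_def)
      then show ?thesis using False by auto
    qed
  qed
  finally show "prob (stay_event t s) = hit_prob [] 1 t * hit_prob a 1 s"
    by (simp add: avg_cmult_right hit_prob_def)
qed

text \<open>Sum the probabilities of the stay events over the times of the first and the second hit. The sum
over the second time gives the factor \<open>p\<close> for each first time, so it cancels in the conditional
probability.\<close>
lemma stay_prob_eq: "stay_prob M X L a b = suminf (hit_prob a 1)"
proof -
  define p where "p = suminf (hit_prob a 1)"
  define A where "A t = {\<omega>\<in>space M. next_hit 0 t \<omega> \<and> end_sgn (prefix_word t \<omega>) = 1}" for t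
  define B where "B t = {\<omega>\<in>A t. hit_sign X L a b 2 \<omega> = 1}" for t
  have A: "A t \<in> events" "prob (A t) = hit_prob [] 1 t" for t
    unfolding A_def by (rule prob_first_hit)+
  have dA: "disjoint_family A"
    unfolding disjoint_family_on_def A_def using next_hit_unique by blast
  have YA: "{\<omega>\<in>space M. hit_sign X L a b 1 \<omega> = 1} = (\<Union>t. A t)"
    unfolding hit_sign_1 A_def by auto
  have YB: "{\<omega>\<in>space M. hit_sign X L a b 2 \<omega> = 1 \<and> hit_sign X L a b 1 \<omega> = 1} = (\<Union>t. B t)"
    unfolding hit_sign_1 A_def B_def by auto
  have B: "B t \<in> events \<and> prob (B t) = hit_prob [] 1 t * p" for t
  proof -
    define N where "N = {\<omega>\<in>B t. \<forall>s. \<not> next_hit t s \<omega>}"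
    \<comment> \<open>When nothing is hit after time \<open>t\<close>, the second hitting time takes the default value of \<open>LEAST\<close>; this concerns a null set, which still has to be measurable.\<close>
    define D where "D = (LEAST k::nat. False)"
    have BN: "B t = (\<Union>s. stay_event t s) \<union> N"
      unfolding B_def A_def N_def stay_event_def using hit_sign_2 by auto
    have "N = {\<omega>\<in>space M. end_sgn (prefix_word D \<omega>) = 1} \<inter> A t \<inter> {\<omega>\<in>space M. \<forall>s. \<not> next_hit t s \<omega>}"
    proof -
      have "hit_sign X L a b 2 \<omega> = 1 \<longleftrightarrow> end_sgn (prefix_word D \<omega>) = 1"
        if "next_hit 0 t \<omega>" "\<forall>s. \<not> next_hit t s \<omega>" for \<omega>
      proof -
        have "hit_time X L a b 1 \<omega> = t" using next_hit_Least[OF that(1)] by simp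
        moreover have "(\<lambda>k. k > t \<and> window X L k \<omega> \<in> {a, b}) = (\<lambda>k. False)"
          unfolding window_iff using that(2) next_hit_exists by blast
        ultimately have "hit_time X L a b 2 \<omega> = D"
          by (simp add: numeral_2_eq_2 D_def)
        then show ?thesis unfolding hit_sign_def window_iff by simp
      qed
      then show ?thesis unfolding N_def B_def A_def by auto
    qed
    then have N: "N \<in> null_sets M"
      using null_set_Int1[OF no_hit_after_null[of t], of "{\<omega>\<in>space M. end_sgn (prefix_word D \<omega>) = 1} \<inter> A t"] A(1)[of t]
        prefix_word_event[of "\<lambda>w. end_sgn w = 1" D] by (simp add: Int_commute sets.Int)
    have U: "(\<Union>s. stay_event t s) \<in> events" using prob_stay_event(1) by auto
    have "(\<lambda>s. prob (stay_event t s)) sums prob (\<Union>s. stay_event t s)"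
    proof (rule finite_measure_UNION)
      show "range (stay_event t) \<subseteq> events" using prob_stay_event(1) by auto
      show "disjoint_family (stay_event t)"
        unfolding disjoint_family_on_def stay_event_def using next_hit_unique by blast
    qed
    moreover have "(\<lambda>s. hit_prob [] 1 t * hit_prob a 1 s) sums (hit_prob [] 1 t * p)"
      unfolding p_def by (intro sums_mult summable_sums hit_prob_summable) auto
    ultimately have "prob (\<Union>s. stay_event t s) = hit_prob [] 1 t * p"
      unfolding prob_stay_event by (rule sums_unique2)
    then show ?thesis
      using measure_Un_null_set[OF U N] U N unfolding BN by (auto simp: null_sets_def)
  qed
  have sA: "(\<lambda>t. hit_prob [] 1 t) sums prob (\<Union>t. A t)"
    unfolding A(2)[symmetric] by (rule finite_measure_UNION) (use A dA in auto)
  have "(\<lambda>t. prob (B t)) sums prob (\<Union>t. B t)"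
  proof (rule finite_measure_UNION)
    show "disjoint_family B" using dA unfolding disjoint_family_on_def B_def by blast
  qed (use B in auto)
  moreover have "(\<lambda>t. hit_prob [] 1 t * p) sums (prob (\<Union>t. A t) * p)"
    by (rule sums_mult2[OF sA])
  ultimately have BA: "prob (\<Union>t. B t) = prob (\<Union>t. A t) * p"
    using B sums_unique2 by simp
  have "hit_prob [] 1 L \<ge> 1 / 2 ^ L"
  proof -
    have "avg L (\<lambda>y. of_bool (y = a) * 1) \<le> avg L (\<lambda>xs. of_bool (first_hit [] xs \<and> end_sgn ([] @ xs) = 1) :: real)"
    proof (rule avg_mono)
      fix y :: "bool list" assume "length y = L"
      have "first_hit [] a \<and> end_sgn a = 1"
      proof -
        have "end_sgn a = 1" using len_a by (simp add: end_sgn_def)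
        moreover have "no_hit [] (butlast a)"
          unfolding no_hit_def using len_a by (auto simp: end_sgn_def intro!: sgn_word_length)
        ultimately show ?thesis using len_a L_pos by (auto simp: first_hit_def)
      qed
      then show "of_bool (y = a) * 1 \<le> (of_bool (first_hit [] y \<and> end_sgn ([] @ y) = 1) :: real)" by auto
    qed
    then show ?thesis using avg_point[OF len_a, of "\<lambda>_. 1 :: real"] by (simp add: hit_prob_def)
  qed
  then have "prob (A L) > 0" unfolding A(2) by (rule less_le_trans[rotated]) simp
  also have "prob (A L) \<le> prob (\<Union>t. A t)"
    using A(1) by (intro finite_measure_mono) auto
  finally have "prob (\<Union>t. A t) > 0" .
  then show ?thesis
    unfolding stay_prob_def cond_prob_def YA YB BA p_def by simp
qed

lemma cond_prob_tie:
  assumes "length v = L" "n \<ge> L"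
  shows "\<P>(\<omega> in M. occurrences X n a \<omega> = occurrences X n b \<omega> \<bar> window X L L \<omega> = v)
    = avg (n - L) (\<lambda>xs. of_bool (score (v @ xs) = 0))"
proof -
  have n: "n = L + (n - L)" using assms by simp
  have w: "window X L L \<omega> = v \<longleftrightarrow> take L (prefix_word n \<omega>) = v" for \<omega>
    using assms by (simp add: window_eq_drop take_prefix_word)
  have o: "occurrences X n a \<omega> = occurrences X n b \<omega> \<longleftrightarrow> score (prefix_word n \<omega>) = 0" for \<omega>
    using occurrences_diff[of n \<omega>] by linarith
  have "\<P>(\<omega> in M. score (prefix_word n \<omega>) = 0 \<and> take L (prefix_word n \<omega>) = v)
      = avg n (\<lambda>xs. of_bool (score xs = 0 \<and> take L xs = v))"
    by (rule prob_prefix_word)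
  also have "\<dots> = avg L (\<lambda>x. avg (n - L) (\<lambda>y. of_bool (x = v) * of_bool (score (x @ y) = 0)))"
    by (subst n, subst avg_append) (auto intro!: avg_cong)
  also have "\<dots> = avg (n - L) (\<lambda>y. of_bool (score (v @ y) = 0)) / 2 ^ L"
    by (simp only: avg_cmult avg_point[OF assms(1)])
  finally have 1: "\<P>(\<omega> in M. score (prefix_word n \<omega>) = 0 \<and> take L (prefix_word n \<omega>) = v)
      = avg (n - L) (\<lambda>y. of_bool (score (v @ y) = 0)) / 2 ^ L" .
  have "\<P>(\<omega> in M. window X L L \<omega> = v) = 1 / 2 ^ L"
    using prefix_word_eq_event(2)[OF assms(1)] by (simp add: window_eq_drop)
  then have 2: "\<P>(\<omega> in M. take L (prefix_word n \<omega>) = v) = 1 / 2 ^ L" by (simp only: w)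
  show ?thesis unfolding cond_prob_def w o 1 2 by simp
qed

end

theorem mainTheorem4:
  fixes M :: "'a measure" and X :: "nat \<Rightarrow> 'a \<Rightarrow> bool"
    and L :: nat and v a b :: "bool list" and p q :: real
  assumes "symmetric_bernoulli_process M X"
    and "L \<ge> 1"
    and "length v = L" and "length a = L" and "length b = L"
    and "b \<notin> {a, rev a, map Not a, rev (map Not a)}"
    and "p = stay_prob M X L a b" and "q = 1 - p"
  shows "(\<lambda>n. \<P>(\<omega> in M. occurrences X n a \<omega> = occurrences X n b \<omega> \<bar> window X L L \<omega> = v)
            - sqrt (2 powi (int L - 2) * q / (p * pi * real n)))
         \<in> o(\<lambda>n. 1 / sqrt (real n))"
proof -
  interpret symmetric_bernoulli_process M X by (rule assms(1))
  interpret process_word_pair M X L a b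
    using assms by unfold_locales auto
  have "\<exists>x y. swap_pair x y" using assms(6) by (intro swap_pair_exists) auto
  note lim = local_limit[OF this, of v]
  define \<kappa> where "\<kappa> = 1 / sqrt (2 * pi * svar)"
  define P where "P n = \<P>(\<omega> in M. occurrences X n a \<omega> = occurrences X n b \<omega> \<bar> window X L L \<omega> = v)" for n
  have svar: "svar = 2 * p / (q * 2 ^ L)"
    using svar_eq stay_prob_eq assms(7,8) by simp
  have q: "q \<noteq> 0" using drift_equation(2) stay_prob_eq assms(7,8) by simp
  have main_term: "sqrt (2 powi (int L - 2) * q / (p * pi * real n)) = \<kappa> / sqrt (real n)" for n
  proof -
    have "(2::real) powi (int L - 2) = 2 ^ L / 4"
      by (simp add: power_int_diff)
    then have "2 powi (int L - 2) * q / (p * pi * real n) = 2 ^ L / 4 * q / (p * pi * real n)"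
      by (simp only:)
    also have "\<dots> = 1 / (2 * pi * svar) / real n"
      using q by (simp add: svar field_simps)
    finally have "2 powi (int L - 2) * q / (p * pi * real n) = 1 / (2 * pi * svar) / real n" .
    then show ?thesis by (simp add: \<kappa>_def real_sqrt_divide real_sqrt_mult)
  qed
  have "(\<lambda>m. sqrt (real (m + L)) * P (m + L)) \<longlonglongrightarrow> \<kappa>"
  proof -
    have "(\<lambda>m. sqrt (real (m + L)) / sqrt (real m)) \<longlonglongrightarrow> 1" by real_asymp
    then have "(\<lambda>m. sqrt (real (m + L)) / sqrt (real m) * (sqrt (real m) * avg m (\<lambda>xs. of_bool (score (v @ xs) = 0)))) \<longlonglongrightarrow> 1 * \<kappa>"
      using lim unfolding \<kappa>_def by (rule tendsto_mult)
    moreover have "\<forall>\<^sub>F m in sequentially. sqrt (real (m + L)) / sqrt (real m) * (sqrt (real m) * avg m (\<lambda>xs. of_bool (score (v @ xs) = 0)))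
       = sqrt (real (m + L)) * P (m + L)"
      using eventually_gt_at_top[of 0]
    proof eventually_elim
      case (elim m)
      have "P (m + L) = avg m (\<lambda>xs. of_bool (score (v @ xs) = 0))"
        unfolding P_def using cond_prob_tie[OF assms(3), of "m + L"] by simp
      then show ?case using elim by simp
    qed
    ultimately have "(\<lambda>m. sqrt (real (m + L)) * P (m + L)) \<longlonglongrightarrow> 1 * \<kappa>"
      by (rule Lim_transform_eventually)
    then show ?thesis by simp
  qed
  then have "(\<lambda>n. sqrt (real n) * P n) \<longlonglongrightarrow> \<kappa>"
    by (rule LIMSEQ_offset)
  then have "(\<lambda>n. sqrt (real n) * P n - \<kappa>) \<longlonglongrightarrow> 0"
    by (simp add: LIM_zero)
  moreover have "\<forall>\<^sub>F n in sequentially. sqrt (real n) * P n - \<kappa> = (P n - \<kappa> / sqrt (real n)) / (1 / sqrt (real n))"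
    using eventually_gt_at_top[of 0] by eventually_elim (simp add: field_simps)
  ultimately have "(\<lambda>n. (P n - \<kappa> / sqrt (real n)) / (1 / sqrt (real n))) \<longlonglongrightarrow> 0"
    by (rule Lim_transform_eventually)
  then have "(\<lambda>n. P n - \<kappa> / sqrt (real n)) \<in> o(\<lambda>n. 1 / sqrt (real n))"
    by (rule smalloI_tendsto) (use eventually_gt_at_top[of 0] in eventually_elim, simp)
  then show ?thesis by (simp only: P_def main_term)
qed

end
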